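(* Let $r\ge 1$ be a fixed integer and let $\boldsymbol{\mu}=(\mu_1,\ldots,\mu_r)$ be a probability distribution with $\mu_i>0$ for $i=1,\ldots,r$ (not depending on $n$). Let $K_1,\ldots,K_r,P:\mathbb{N}_0\to\mathbb{N}_0^{r+1}$ be a scaling. Let $|\Sigma|_n$ denote a random variable that takes the value $K_{i,n}$ with probability $\mu_i$ for each $i=1,\ldots,r$. If $$\frac{K_{1,n}\,\mathbb{E}[|\Sigma|_n]}{P_n}\sim c\,\frac{\log n}{n}$$ for some $c>0$, then $$\lim_{n\to\infty}\mathbb{P}\left[\mathbb{G}(n;\boldsymbol{\mu},\boldsymbol{K}_n,P_n)\text{ has no isolated nodes}\right]=\begin{cases}0 & \text{if } c<1,\\ 1 & \text{if } c>1.\end{cases}$$ If, in addition, $P_n=\Omega(n)$ and $\frac{(K_{1,n})^2}{P_n}=\omega\left(\frac1n\right)$, then also $$\lim_{n\to\infty}\mathbb{P}\left[\mathbb{G}(n;\boldsymbol{\mu},\boldsymbol{K}_n,P_n)\text{ is connected}\right]=\begin{cases}0 & \text{if } c<1,\\ 1 & \text{if } c>1.\end{cases}$$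
   Context: A scaling is a mapping $K_1,\ldots,K_r,P:\mathbb{N}_0\to\mathbb{N}_0^{r+1}$ (with values written $K_{1,n},\ldots,K_{r,n},P_n$) such that $1\le K_{1,n}\le K_{2,n}\le\cdots\le K_{r,n}<P_n$ for all $n=2,3,\ldots$. Write $\boldsymbol{K}_n=(K_{1,n},\ldots,K_{r,n})$. Inhomogeneous random key graph $\mathbb{G}(n;\boldsymbol{\mu},\boldsymbol{K},P)$: the vertex set is $\{v_1,\ldots,v_n\}$. Each node is independently assigned a class in $\{1,\ldots,r\}$, being of class $i$ with probability $\mu_i$. A class-$i$ node $v_x$ is given a key ring $\Sigma_x$ which is a uniformly random subset of $\{1,\ldots,P\}$ of size $K_i$; the random sets $\Sigma_1,\ldots,\Sigma_n$ are independent and identically distributed. Two distinct nodes $v_x,v_y$ are adjacent if and only if $\Sigma_x\cap\Sigma_y\ne\emptyset$. A node is isolated if it has no neighbors. All asymptotic statements are for $n\to\infty$; $a_n\sim b_n$ means $\lim a_n/b_n=1$; $P_n=\Omega(n)$ means there is $\sigma>0$ with $P_n\ge\sigma n$ for all $n$ sufficiently large; $a_n=\omega(b_n)$ means $a_n/b_n\to\infty$. *)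

theory Defs
  imports
    "HOL-Probability.Probability"
    "HOL-Library.Landau_Symbols"
    "Graph_Theory.Graph_Theory"
begin

text \<open>
  Classes are the numbers \<open>1, \<dots>, r\<close>, and \<open>K n i\<close> stands for $K_{i,n}$. The monotonicity
  constraints are imposed only for \<open>n \<ge> 2\<close>.
\<close>

definition scaling :: "nat \<Rightarrow> (nat \<Rightarrow> nat \<Rightarrow> nat) \<Rightarrow> (nat \<Rightarrow> nat) \<Rightarrow> bool" where
  "scaling r K P \<longleftrightarrow>
     (\<forall>n\<ge>2. 1 \<le> K n 1 \<and> (\<forall>i\<in>{1..<r}. K n i \<le> K n (Suc i)) \<and> K n r < P n)"

text \<open>
  The law of the key ring of a single node: first its class is drawn from \<open>\<mu>\<close>, then a uniformly
  random subset of \<open>{1..P}\<close> of the size belonging to that class. If \<open>K i > P\<close> there is no such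
  subset and \<^const>\<open>pmf_of_set\<close> is unspecified; a scaling excludes this for \<open>n \<ge> 2\<close>.
\<close>

definition key_ring_pmf :: "nat pmf \<Rightarrow> (nat \<Rightarrow> nat) \<Rightarrow> nat \<Rightarrow> nat set pmf" where
  "key_ring_pmf \<mu> K P = bind_pmf \<mu> (\<lambda>i. pmf_of_set {S. S \<subseteq> {1..P} \<and> card S = K i})"

text \<open>
  Undirected simple graphs are represented as in \<^locale>\<open>pair_graph\<close>: an edge is a pair of
  opposite arcs.
\<close>

definition key_graph :: "nat \<Rightarrow> (nat \<Rightarrow> nat set) \<Rightarrow> nat pair_pre_digraph" where
  "key_graph n \<Sigma> =
     \<lparr>pverts = {1..n},
      parcs = {(x, y). x \<in> {1..n} \<and> y \<in> {1..n} \<and> x \<noteq> y \<and> \<Sigma> x \<inter> \<Sigma> y \<noteq> {}}\<rparr>"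

lemma pair_graph_key_graph: "pair_graph (key_graph n \<Sigma>)"
proof
  show "finite (parcs (key_graph n \<Sigma>))"
    by (rule finite_subset[of _ "{1..n} \<times> {1..n}"]) (auto simp: key_graph_def)
qed (auto simp: key_graph_def arcs_ends_def arc_to_ends_def symmetric_def intro!: symI)

text \<open>
  The inhomogeneous random key graph, as a probability distribution on graphs. The default
  value \<open>{}\<close> is the key ring of the non-nodes \<open>x \<notin> {1..n}\<close>, which play no role.
\<close>

definition inhom_random_key_graph ::
    "nat \<Rightarrow> nat pmf \<Rightarrow> (nat \<Rightarrow> nat) \<Rightarrow> nat \<Rightarrow> nat pair_pre_digraph pmf" where
  "inhom_random_key_graph n \<mu> K P =
     map_pmf (key_graph n) (Pi_pmf {1..n} {} (\<lambda>_. key_ring_pmf \<mu> K P))"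

definition isolated_node :: "('a, 'b) pre_digraph \<Rightarrow> 'a \<Rightarrow> bool" where
  "isolated_node G v \<longleftrightarrow> v \<in> verts G \<and> \<not> (\<exists>u. v \<rightarrow>\<^bsub>G\<^esub> u \<or> u \<rightarrow>\<^bsub>G\<^esub> v)"

end

theory Submission
  imports Defs "HOL-Real_Asymp.Real_Asymp"
begin

text \<open>
  The whole argument runs on one quantity, the probability that a fresh key ring \<open>\<Sigma>\<close> avoids a given
  set of \<open>u\<close> keys. It is the mean of \<open>C(P - u, |\<Sigma>|) / C(P, |\<Sigma>|)\<close>, and it lies between
  \<open>1 - u E|\<Sigma>| / P\<close> (\<open>expectation_avoid_ge\<close>) and the Laplace transform \<open>L(u) = E exp(- u |\<Sigma>| / P)\<close>
  (\<open>miss_le_exp\<close>). Given the rings of a set \<open>S\<close> of nodes, the other rings are still independent,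
  so \<open>S\<close> has no edge to the outside with conditional probability equal to the \<open>(n - |S|)\<close>-th power of
  the probability of avoiding the union \<open>U(S)\<close> of the rings in \<open>S\<close> (\<open>prob_separated\<close>).

  \<^emph>\<open>Isolated nodes.\<close> Every ring has at least \<open>K\<^sub>1\<close> keys, so the expected number of isolated nodes is at
  most about \<open>n exp(- n K\<^sub>1 E|\<Sigma>| / P)\<close>, which is \<open>n powr (1 - c + o(1))\<close>. For \<open>c > 1\<close> it vanishes
  (\<open>prob_isolated_le\<close>). For \<open>c < 1\<close> the second moment method is applied to the isolated
  nodes with exactly \<open>K\<^sub>1\<close> keys (\<open>prob_no_isolated_le\<close>): their mean number \<open>n powr (1 - c + o(1))\<close>
  tends to infinity, and two of them have disjoint rings, which a fresh ring avoids with a probability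
  exceeding the square of the one for a single ring by at most \<open>O((log n / n)\<^sup>2)\<close>.

  \<^emph>\<open>Connectivity.\<close> A connected graph on at least two nodes has no isolated node, which settles
  \<open>c < 1\<close>. For \<open>c > 1\<close>, a disconnected graph has a nonempty set \<open>S\<close> of \<open>s \<le> n / 2\<close> nodes without edges
  to the outside. Put \<open>w = n K\<^sub>1\<^sup>2 / P\<close>, which tends to infinity by hypothesis, fix \<open>\<theta> < 1\<close> with
  \<open>\<theta>\<^sup>2 c > 1\<close>, and let \<open>t = w powr (-3/4)\<close>, \<open>m = \<lfloor>n t\<rfloor>\<close>. Three union bounds
  (\<open>prob_cut_le\<close>, \<open>prob_cut_le_explicit\<close>) cover all cases.

  \<^item> With high probability every \<open>S\<close> with \<open>s \<le> m\<close> satisfies \<open>|U(S)| \<ge> \<theta> s K\<^sub>1\<close>, that is, the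
    rings of few nodes hardly overlap (\<open>prob_small_union_le\<close>). Here \<open>P = \<Omega>(n)\<close> enters: it gives
    \<open>w = O(K\<^sub>1\<^sup>2)\<close>, hence \<open>K\<^sub>1\<close> tends to infinity and \<open>m\<close> rings of size \<open>K\<^sub>1\<close> fill only a vanishing
    fraction of the pool.

  \<^item> If \<open>s \<le> m\<close> and \<open>|U(S)| \<ge> \<theta> s K\<^sub>1\<close>, then \<open>S\<close> is cut off with probability at most
    \<open>L(\<theta> s K\<^sub>1) ^ (n - s)\<close>. As long as \<open>L\<close> is nearly linear, this is below \<open>n powr (- (1 + \<epsilon>) s)\<close>
    and beats the number \<open>C(n, s) \<le> n ^ s\<close> of sets. Otherwise \<open>L\<close> is bounded away from \<open>1\<close>, the
    bound is exponentially small in \<open>n\<close>, and \<open>C(n, s) = exp(o(n))\<close> because \<open>s \<le> t n\<close> with \<open>t\<close>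
    tending to \<open>0\<close> (\<open>separated_sum_le\<close>).

  \<^item> If \<open>s > m\<close>, then \<open>U(S)\<close> contains the union of \<open>m\<close> rings, and
    \<open>L(\<theta> m K\<^sub>1) \<le> exp(- \<theta> m K\<^sub>1\<^sup>2 / P)\<close>, where \<open>m K\<^sub>1\<^sup>2 / P\<close> is of order \<open>t w = w powr (1/4)\<close>. So the base
    tends to \<open>0\<close>, and its power \<open>n / 2\<close> beats even the total number \<open>2 ^ n\<close> of sets
    (\<open>large_cut_le\<close>).

  The choice of \<open>t\<close> balances the first and the last case: \<open>t w\<close> must tend to infinity while
  \<open>t w / K\<^sub>1\<close>, the part of the pool covered by \<open>m\<close> rings, tends to \<open>0\<close>.
\<close>

section \<open>Uniformly random sets of keys\<close>

text \<open>
  For \<open>u, j \<le> P\<close>, this is the probability that a uniformly random \<open>j\<close>-subset of a pool of \<open>P\<close> keys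
  contains none of \<open>u\<close> given keys.
\<close>
definition avoid :: "nat \<Rightarrow> nat \<Rightarrow> nat \<Rightarrow> real" where
  "avoid P u j = real ((P - u) choose j) / real (P choose j)"

lemma binomial_step: "real (Suc k) * real (n choose Suc k) = real (n - k) * real (n choose k)"
proof (cases "k < n")
  case True
  then obtain m where n: "n = Suc m" by (cases n) auto
  have "Suc k * (n choose Suc k) = (n - k) * (n choose k)"
    using binomial_absorb_comp[of n k] Suc_times_binomial[of k m] unfolding n by simp
  then show ?thesis by (metis of_nat_mult)
next
  case False
  then show ?thesis by (cases "n = k") (auto simp: binomial_eq_0)
qed

text \<open>
  The ratio is a product of the factors \<open>(x - i) / (P - i)\<close>; this recursion drives the inductive
  estimates below.
\<close>
lemma choose_ratio_Suc:
  "real (x choose Suc j) / real (P choose Suc j)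
       = real (x choose j) / real (P choose j) * (real (x - j) / real (P - j))"
proof -
  have "real (x choose Suc j) / real (P choose Suc j)
      = (real (Suc j) * real (x choose Suc j)) / (real (Suc j) * real (P choose Suc j))"
    by (simp only: mult_divide_mult_cancel_left_if) simp
  also have "\<dots> = (real (x - j) * real (x choose j)) / (real (P - j) * real (P choose j))"
    by (simp only: binomial_step)
  finally show ?thesis by (simp add: mult.commute)
qed

lemma choose_ratio_le_power:
  assumes "j \<le> P" "x \<le> P"
  shows "real (x choose j) / real (P choose j) \<le> (real x / real P) ^ j"
  using assms(1)
proof (induction j)
  case (Suc j)
  have "real (x - j) / real (P - j) \<le> real x / real P"
  proof (cases "j \<le> x")
    case True
    have "real j * real x \<le> real j * real P" using assms by (intro mult_left_mono) auto
    then show ?thesis using Suc.prems True assms by (simp add: of_nat_diff divide_simps algebra_simps)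
  qed auto
  then have "real (x choose j) / real (P choose j) * (real (x - j) / real (P - j))
      \<le> (real x / real P) ^ j * (real x / real P)"
    using Suc by (intro mult_mono) auto
  then show ?case by (simp add: choose_ratio_Suc mult.commute)
qed simp

lemma avoid_le_exp:
  assumes "j \<le> P" "u \<le> P" 
  shows "avoid P u j \<le> exp (- (real u * real j / real P))"
proof (cases "P = 0")
  case False
  have "avoid P u j \<le> (real (P - u) / real P) ^ j"
    unfolding avoid_def using assms by (intro choose_ratio_le_power) auto
  also have "real (P - u) / real P = 1 - real u / real P"
    using assms False by (simp add: of_nat_diff field_simps)
  also have "(1 - real u / real P) ^ j \<le> exp (- (real u / real P)) ^ j"
    using assms False exp_ge_add_one_self[of "- (real u / real P)"] by (intro power_mono) (auto simp: field_simps)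
  also have "\<dots> = exp (- (real u * real j / real P))"
    by (simp add: exp_of_nat_mult [symmetric] mult.commute)
  finally show ?thesis .
qed (use assms in \<open>auto simp: avoid_def\<close>)

text \<open>
  Passing from \<open>u\<close> to \<open>u + 1\<close> forbidden keys loses only subsets that contain the new key, and these
  are at most a fraction \<open>j / P\<close> of all \<open>j\<close>-subsets.
\<close>
lemma avoid_ge:
  assumes "j \<le> P" "u \<le> P"
  shows "1 - real u * real j / real P \<le> avoid P u j"
proof (cases "P = 0 \<or> j = 0")
  case False
  then obtain p i where p: "P = Suc p" and i: "j = Suc i" by (cases P; cases j) auto
  have *: "real (P choose j) \<le> real ((P - u) choose j) + real u * real (p choose i)"
    using assms(2)
  proof (induction u)
    case (Suc u)
    have "P - u = Suc (P - Suc u)" using Suc.prems by auto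
    then have "(P - u) choose j = ((P - Suc u) choose i) + ((P - Suc u) choose j)"
      by (simp add: i)
    moreover have "((P - Suc u) choose i) \<le> (p choose i)" 
      using Suc.prems by (intro binomial_right_mono) (simp add: p)
    ultimately show ?case using Suc by (simp add: algebra_simps)
  qed simp
  have "real j * real (P choose j) = real P * real (p choose i)"
    using Suc_times_binomial[of i p] unfolding p i by (metis of_nat_mult)
  then have "real u * real (p choose i) = real (P choose j) * (real u * real j / real P)"
    using False by (simp add: field_simps)
  then show ?thesis using * assms unfolding avoid_def by (simp add: field_simps)
qed (use assms in \<open>auto simp: avoid_def\<close>)

lemma avoid_nonneg: "0 \<le> avoid P u j" by (simp add: avoid_def)

lemma avoid_le_1: "avoid P u j \<le> 1"
proof -
  have "((P - u) choose j) \<le> (P choose j)" by (intro binomial_right_mono) simp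
  then show ?thesis by (auto simp: avoid_def divide_le_eq_1)
qed

text \<open>
  Avoiding two disjoint sets of \<open>u\<close> keys is negatively correlated: factor by factor, the claim is
  \<open>(a - 2 u) a \<le> (a - u)\<^sup>2\<close>.
\<close>
lemma avoid_double:
  assumes "j \<le> P"
  shows "avoid P (2 * u) j \<le> (avoid P u j)\<^sup>2"
  using assms
proof (induction j)
  case (Suc j)
  have "real (P - 2 * u - j) / real (P - j) \<le> (real (P - u - j) / real (P - j))\<^sup>2"
  proof (cases "2 * u + j \<le> P")
    case True
    define a where "a = real P - real j"
    have "real (P - 2 * u - j) = a - 2 * real u" "real (P - u - j) = a - real u" "real (P - j) = a" 
      using True by (auto simp: a_def)
    moreover have "a > 0" using Suc.prems by (simp add: a_def)
    moreover have "(a - 2 * real u) * a \<le> (a - real u)\<^sup>2" by (simp add: power2_eq_square algebra_simps)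
    ultimately show ?thesis by (simp add: field_simps power2_eq_square)
  qed auto
  then have "avoid P (2 * u) j * (real (P - 2 * u - j) / real (P - j)) \<le> (avoid P u j)\<^sup>2 * (real (P - u - j) / real (P - j))\<^sup>2"
    using Suc by (intro mult_mono) (auto simp: avoid_nonneg)
  then show ?case 
    unfolding avoid_def by (simp only: choose_ratio_Suc power_mult_distrib)
qed (simp add: avoid_def)

text \<open>
  The familiar bound \<open>C(n, x) \<le> (e n / x) ^ x\<close>: the term \<open>C(n, x) (x / n) ^ x\<close> is one of the
  nonnegative terms of the expansion of \<open>(1 + x / n) ^ n \<le> exp x\<close>.
\<close>
lemma binomial_le_exp:
  assumes "x > 0" "x \<le> n"
  shows "real (n choose x) \<le> exp (real x * (1 + ln (real n / real x)))"
proof -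
  have n: "real n > 0" "real x > 0" using assms by auto
  have "real (n choose x) * (real x / real n) ^ x = (\<Sum>k\<in>{x}. real (n choose k) * (real x / real n) ^ k * 1 ^ (n - k))" by simp
  also have "\<dots> \<le> (\<Sum>k\<le>n. real (n choose k) * (real x / real n) ^ k * 1 ^ (n - k))"
    using assms by (intro sum_mono2) auto
  also have "\<dots> = (real x / real n + 1) ^ n" by (rule binomial_ring [symmetric])
  also have "\<dots> \<le> exp (real x / real n) ^ n"
    using exp_ge_add_one_self[of "real x / real n"] by (intro power_mono) (auto simp: add.commute)
  also have "\<dots> = exp (real x)" using n by (simp add: exp_of_nat_mult [symmetric])
  finally have "real (n choose x) \<le> exp (real x) * (real n / real x) ^ x"
    using n by (simp add: field_simps)
  also have "(real n / real x) ^ x = exp (real x * ln (real n / real x))"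
    using n by (simp add: exp_of_nat_mult)
  finally show ?thesis by (simp add: algebra_simps exp_add)
qed

section \<open>The law of a key ring\<close>

lemma measure_bind_pmf:
  "measure_pmf.prob (bind_pmf M f) X = measure_pmf.expectation M (\<lambda>x. measure_pmf.prob (f x) X)"
  using emeasure_bind_pmf[of M f X]
  by (simp add: measure_pmf.emeasure_eq_measure, subst (asm) nn_integral_eq_integral)
     (auto intro!: measure_pmf.integrable_const_bound[where B=1])

definition miss :: "'k set pmf \<Rightarrow> 'k set \<Rightarrow> real" where
  "miss D T = measure_pmf.prob D {A. A \<inter> T = {}}"

lemma miss_nonneg: "0 \<le> miss D T" by (simp add: miss_def)
lemma miss_le_1: "miss D T \<le> 1" by (simp add: miss_def)

text \<open>
  The number \<open>k\<close> is a positive lower bound for all ring sizes; it is instantiated with the size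
  belonging to the first class.
\<close>
locale key_ring_law =
  fixes \<mu> :: "nat pmf" and K :: "nat \<Rightarrow> nat" and P k :: nat
  assumes finite_classes: "finite (set_pmf \<mu>)"
    and K_le: "\<And>i. i \<in> set_pmf \<mu> \<Longrightarrow> K i \<le> P"
    and k_le: "\<And>i. i \<in> set_pmf \<mu> \<Longrightarrow> k \<le> K i"
    and k_pos: "k > 0"
begin

abbreviation "D \<equiv> key_ring_pmf \<mu> K P"

lemma P_pos: "P > 0"
proof -
  obtain i where "i \<in> set_pmf \<mu>" using set_pmf_not_empty[of \<mu>] by blast
  then show ?thesis using K_le[of i] k_le[of i] k_pos by simp
qed

lemma key_rings_of_size:
  fixes j :: nat
  shows "finite {S. S \<subseteq> {1..P} \<and> card S = j}"
    and "card {S. S \<subseteq> {1..P} \<and> card S = j} = (P choose j)"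
  using n_subsets[of "{1..P}" j] by auto

lemma key_rings_of_size_nonempty:
  assumes "i \<in> set_pmf \<mu>" shows "{S. S \<subseteq> {1..P} \<and> card S = K i} \<noteq> {}"
  using key_rings_of_size(2)[of "K i"] K_le[OF assms] 
  by (metis binomial_eq_0_iff card.empty not_le)

lemma set_key_ring_pmf:
  "set_pmf D = {S. S \<subseteq> {1..P} \<and> card S \<in> K ` set_pmf \<mu>}"
proof -
  have "set_pmf (pmf_of_set {S. S \<subseteq> {1..P} \<and> card S = K i}) = {S. S \<subseteq> {1..P} \<and> card S = K i}"
    if "i \<in> set_pmf \<mu>" for i
    using key_rings_of_size_nonempty[OF that] key_rings_of_size(1) by (rule set_pmf_of_set)
  then show ?thesis unfolding key_ring_pmf_def by (auto simp: set_bind_pmf)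
qed

lemma prob_key_ring_pmf:
  "measure_pmf.prob D X = measure_pmf.expectation \<mu>
     (\<lambda>i. real (card ({S. S \<subseteq> {1..P} \<and> card S = K i} \<inter> X)) / real (P choose K i))"
  unfolding key_ring_pmf_def measure_bind_pmf
proof (intro integral_cong_AE)
  show "AE i in measure_pmf \<mu>. measure_pmf.prob (pmf_of_set {S. S \<subseteq> {1..P} \<and> card S = K i}) X
      = real (card ({S. S \<subseteq> {1..P} \<and> card S = K i} \<inter> X)) / real (P choose K i)"
    unfolding AE_measure_pmf_iff
    using key_rings_of_size key_rings_of_size_nonempty by (auto simp: measure_pmf_of_set)
qed auto

lemma miss_key_ring_pmf:
  assumes "T \<subseteq> {1..P}"
  shows "miss D T = measure_pmf.expectation \<mu> (\<lambda>i. avoid P (card T) (K i))"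
proof -
  have "card ({S. S \<subseteq> {1..P} \<and> card S = k} \<inter> {A. A \<inter> T = {}}) = (P - card T) choose k" for k
  proof -
    have "{S. S \<subseteq> {1..P} \<and> card S = k} \<inter> {A. A \<inter> T = {}} = {S. S \<subseteq> {1..P} - T \<and> card S = k}"
      by auto
    moreover have "card ({1..P} - T) = P - card T" using assms by (simp add: card_Diff_subset finite_subset)
    ultimately show ?thesis using n_subsets[of "{1..P} - T" k] by simp
  qed
  then show ?thesis unfolding miss_def prob_key_ring_pmf avoid_def by simp
qed

text \<open>
  Drawing the keys one after the other, each of them falls into \<open>T\<close> with conditional probability at
  most \<open>|T| / P\<close>, and at least \<open>k\<close> keys are drawn.
\<close>
lemma prob_key_ring_subset_le:
  assumes "T \<subseteq> {1..P}"
  shows "measure_pmf.prob D {A. A \<subseteq> T} \<le> (real (card T) / real P) ^ k"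
proof -
  have T: "card T \<le> P" "finite T" using card_mono[OF _ assms(1)] assms(1) finite_subset by auto
  have "card ({S. S \<subseteq> {1..P} \<and> card S = j} \<inter> {A. A \<subseteq> T}) = card T choose j" for j
  proof -
    have "{S. S \<subseteq> {1..P} \<and> card S = j} \<inter> {A. A \<subseteq> T} = {S. S \<subseteq> T \<and> card S = j}"
      using assms by auto
    then show ?thesis using n_subsets[of T j] T by simp
  qed
  then have "measure_pmf.prob D {A. A \<subseteq> T}
      = measure_pmf.expectation \<mu> (\<lambda>i. real (card T choose K i) / real (P choose K i))"
    unfolding prob_key_ring_pmf by simp
  also have "\<dots> \<le> measure_pmf.expectation \<mu> (\<lambda>i. (real (card T) / real P) ^ k)"
  proof (intro integral_mono_AE measure_pmf.integrable_const_bound[where B=1])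
    have *: "real (card T choose K i) / real (P choose K i) \<le> (real (card T) / real P) ^ k"
      if "i \<in> set_pmf \<mu>" for i
    proof -
      have "real (card T choose K i) / real (P choose K i) \<le> (real (card T) / real P) ^ K i"
        using K_le that T by (intro choose_ratio_le_power) auto
      also have "\<dots> \<le> (real (card T) / real P) ^ k"
        using T P_pos by (intro power_decreasing k_le that) auto
      finally show ?thesis .
    qed
    then show "AE i in measure_pmf \<mu>. real (card T choose K i) / real (P choose K i) \<le> (real (card T) / real P) ^ k"
      unfolding AE_measure_pmf_iff by blast
    have "(real (card T) / real P) ^ k \<le> 1" using T P_pos by (intro power_le_one) auto
    then show "AE i in measure_pmf \<mu>. norm (real (card T choose K i) / real (P choose K i)) \<le> 1"
      unfolding AE_measure_pmf_iff using * by force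
    show "AE i in measure_pmf \<mu>. norm ((real (card T) / real P) ^ k) \<le> 1"
      using \<open>(real (card T) / real P) ^ k \<le> 1\<close> by simp
  qed auto
  finally show ?thesis by simp
qed

lemma miss_le_exp:
  assumes "T \<subseteq> {1..P}" "a \<le> real (card T)"
  shows "miss D T \<le> measure_pmf.expectation \<mu> (\<lambda>i. exp (- (a * real (K i) / real P)))"
proof -
  have "card T \<le> P" using card_mono[OF _ assms(1)] by auto
  have *: "avoid P (card T) (K i) \<le> exp (- (a * real (K i) / real P))" if "i \<in> set_pmf \<mu>" for i
  proof -
    have "avoid P (card T) (K i) \<le> exp (- (real (card T) * real (K i) / real P))"
      using \<open>card T \<le> P\<close> K_le that by (intro avoid_le_exp) auto
    also have "\<dots> \<le> exp (- (a * real (K i) / real P))"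
      using assms by (auto intro!: divide_right_mono mult_right_mono)
    finally show ?thesis .
  qed
  show ?thesis unfolding miss_key_ring_pmf[OF assms(1)]
    by (intro integral_mono_AE integrable_measure_pmf_finite finite_classes) (simp add: AE_measure_pmf_iff *)
qed

end

section \<open>Node sets without edges to the remaining nodes\<close>

lemma measure_pair_pmf:
  "measure_pmf.prob (pair_pmf M N) X
     = measure_pmf.expectation M (\<lambda>x. measure_pmf.prob N {y. (x, y) \<in> X})"
proof -
  have "pair_pmf M N = bind_pmf M (\<lambda>x. map_pmf (Pair x) N)"
    by (simp add: pair_pmf_def map_pmf_def)
  then show ?thesis by (simp add: measure_bind_pmf vimage_def)
qed

text \<open>
  In the key graph of \<open>\<Sigma>\<close>, there is no edge between \<open>S\<close> and \<open>V - S\<close>. Isolated nodes are the case of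
  a singleton, and a graph is disconnected when some nontrivial \<open>S\<close> has this property.
\<close>
definition separated :: "'v set \<Rightarrow> ('v \<Rightarrow> 'k set) \<Rightarrow> 'v set \<Rightarrow> bool" where
  "separated V \<Sigma> S \<longleftrightarrow> (\<forall>x\<in>S. \<forall>y\<in>V - S. \<Sigma> x \<inter> \<Sigma> y = {})"

text \<open>
  The product distribution splits into the rings of \<open>S\<close> and the independent rings of \<open>V - S\<close>. Once
  the former are fixed, separation says that each of the latter avoids the fixed set
  \<open>\<Union>x\<in>S. f x\<close>. The predicate \<open>R\<close> carries any further condition on the rings of \<open>S\<close>.
\<close>
lemma prob_separated:
  fixes D :: "'k set pmf" and V S :: "'v set"
  assumes V: "finite V" "S \<subseteq> V"
    and R: "\<And>f g. (\<forall>x\<in>S. f x = g x) \<Longrightarrow> R f \<longleftrightarrow> R g"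
  shows "measure_pmf.prob (Pi_pmf V {} (\<lambda>_. D)) {\<Sigma>. R \<Sigma> \<and> separated V \<Sigma> S}
       = measure_pmf.expectation (Pi_pmf S {} (\<lambda>_. D))
           (\<lambda>f. of_bool (R f) * miss D (\<Union>x\<in>S. f x) ^ card (V - S))"
proof -
  have fin: "finite S" "finite (V - S)" using V finite_subset by auto
  let ?W = "Pi_pmf (V - S) {} (\<lambda>_. D)"
  have eq: "Pi_pmf V {} (\<lambda>_. D) = map_pmf (\<lambda>(f, g) x. if x \<in> S then f x else g x)
          (pair_pmf (Pi_pmf S {} (\<lambda>_. D)) ?W)"
    using Pi_pmf_union[of S "V - S" "{}" "\<lambda>_. D"] fin V by (simp add: Un_absorb1)
  have "measure_pmf.prob ?W {g. R (\<lambda>x. if x \<in> S then f x else g x)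
            \<and> separated V (\<lambda>x. if x \<in> S then f x else g x) S}
        = of_bool (R f) * miss D (\<Union>x\<in>S. f x) ^ card (V - S)" for f
  proof (cases "R f")
    case True
    then have *: "R (\<lambda>x. if x \<in> S then f x else g x)" for g
      using R[of f "\<lambda>x. if x \<in> S then f x else g x"] by auto
    have "{g. R (\<lambda>x. if x \<in> S then f x else g x)
            \<and> separated V (\<lambda>x. if x \<in> S then f x else g x) S}
         = Pi (V - S) (\<lambda>_. {A. A \<inter> (\<Union>x\<in>S. f x) = {}})"
      unfolding separated_def using * by (auto simp: Pi_iff)
    then show ?thesis using True fin by (simp add: measure_Pi_pmf_Pi miss_def)
  next
    case False
    then have "\<not> R (\<lambda>x. if x \<in> S then f x else g x)" for g
      using R[of f "\<lambda>x. if x \<in> S then f x else g x"] by auto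
    then show ?thesis using False by simp
  qed
  then show ?thesis unfolding eq by (simp add: measure_pair_pmf vimage_def)
qed

lemma integrable_of_bool_power_miss:
  "integrable (measure_pmf M) (\<lambda>f. of_bool (R f) * miss D (U f) ^ k :: real)"
  by (intro measure_pmf.integrable_const_bound[where B=1])
     (auto intro!: power_le_one simp: miss_nonneg miss_le_1 )

lemma expectation_of_bool: "measure_pmf.expectation M (\<lambda>f. of_bool (R f)) = measure_pmf.prob M {f. R f}"
proof -
  have "(\<lambda>f. of_bool (R f) :: real) = indicator {f. R f}" by (auto simp: indicator_def)
  then show ?thesis by simp
qed

lemma prob_separated_le:
  fixes D :: "'k set pmf" and V S :: "'v set"
  assumes V: "finite V" "S \<subseteq> V"
    and R: "\<And>f g. (\<forall>x\<in>S. f x = g x) \<Longrightarrow> R f \<longleftrightarrow> R g"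
    and h: "\<And>f. (\<forall>x\<in>S. f x \<in> set_pmf D) \<Longrightarrow> R f \<Longrightarrow> miss D (\<Union>x\<in>S. f x) \<le> h"
    and "0 \<le> h"
  shows "measure_pmf.prob (Pi_pmf V {} (\<lambda>_. D)) {\<Sigma>. R \<Sigma> \<and> separated V \<Sigma> S}
       \<le> measure_pmf.prob (Pi_pmf S {} (\<lambda>_. D)) {f. R f} * h ^ card (V - S)"
proof -
  have fin: "finite S" using V finite_subset by auto
  have "measure_pmf.expectation (Pi_pmf S {} (\<lambda>_. D))
           (\<lambda>f. of_bool (R f) * miss D (\<Union>x\<in>S. f x) ^ card (V - S))
      \<le> measure_pmf.expectation (Pi_pmf S {} (\<lambda>_. D)) (\<lambda>f. of_bool (R f) * h ^ card (V - S))"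
    using h \<open>0 \<le> h\<close> set_Pi_pmf_subset'[OF fin, of "{}" "\<lambda>_. D"]
    by (intro integral_mono_AE measure_pmf.integrable_const_bound[where B="h ^ card (V - S)"] integrable_of_bool_power_miss)
       (auto simp: AE_measure_pmf_iff PiE_dflt_def subset_iff intro!: power_mono miss_nonneg)
  also have "\<dots> = measure_pmf.prob (Pi_pmf S {} (\<lambda>_. D)) {f. R f} * h ^ card (V - S)"
    by (simp add: expectation_of_bool)
  finally show ?thesis by (subst prob_separated[OF V R])
qed

lemma prob_separated_singleton:
  fixes D :: "'k set pmf" and V :: "'v set"
  assumes V: "finite V" "x \<in> V"
    and h: "\<And>A. A \<in> set_pmf D \<Longrightarrow> Q A \<Longrightarrow> miss D A = h"
  shows "measure_pmf.prob (Pi_pmf V {} (\<lambda>_. D)) {\<Sigma>. Q (\<Sigma> x) \<and> separated V \<Sigma> {x}}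
       = measure_pmf.prob D {A. Q A} * h ^ (card V - 1)"
proof -
  have "measure_pmf.expectation (Pi_pmf {x} {} (\<lambda>_. D))
           (\<lambda>f. of_bool (Q (f x)) * miss D (\<Union>x\<in>{x}. f x) ^ card (V - {x}))
      = measure_pmf.expectation D (\<lambda>A. of_bool (Q A) * miss D A ^ card (V - {x}))"
    by (subst Pi_pmf_singleton) simp
  also have "\<dots> = measure_pmf.expectation D (\<lambda>A. of_bool (Q A) * h ^ card (V - {x}))"
    using h by (intro integral_cong_AE) (auto simp: AE_measure_pmf_iff)
  also have "\<dots> = measure_pmf.prob D {A. Q A} * h ^ (card V - 1)"
    using V by (simp add: expectation_of_bool)
  finally show ?thesis using V by (subst prob_separated) auto
qed

section \<open>Isolated nodes below the threshold\<close>

text \<open>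
  If \<open>X\<close> counts the events that occur, then \<open>(1 - X / p)\<^sup>2\<close> dominates the indicator of \<open>X = 0\<close>, and its
  expectation is \<open>E X\<^sup>2 / p\<^sup>2 - 1\<close> since \<open>E X = p\<close>.
\<close>
lemma second_moment:
  fixes M :: "'a pmf" and B :: "'i \<Rightarrow> 'a set"
  assumes "finite I" and p: "p = (\<Sum>x\<in>I. measure_pmf.prob M (B x))" "p > 0"
  shows "measure_pmf.prob M {\<omega>. \<forall>x\<in>I. \<omega> \<notin> B x}
       \<le> (\<Sum>x\<in>I. \<Sum>y\<in>I. measure_pmf.prob M (B x \<inter> B y)) / p\<^sup>2 - 1"
proof -
  define X where "X \<omega> = (\<Sum>x\<in>I. indicator (B x) \<omega> :: real)" for \<omega>
  have ind: "integrable (measure_pmf M) (indicator Y :: _ \<Rightarrow> real)" for Y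
    by (rule measure_pmf.integrable_const_bound[where B=1]) auto
  have X: "integrable (measure_pmf M) X" "measure_pmf.expectation M X = p"
    unfolding X_def p by (auto intro!: ind simp: Bochner_Integration.integral_sum[OF ind])
  have sq: "(X \<omega>)\<^sup>2 = (\<Sum>x\<in>I. \<Sum>y\<in>I. indicator (B x \<inter> B y) \<omega>)" for \<omega>
    unfolding X_def power2_eq_square sum_product by (simp add: indicator_inter_arith)
  have X2: "integrable (measure_pmf M) (\<lambda>\<omega>. (X \<omega>)\<^sup>2)"
    "measure_pmf.expectation M (\<lambda>\<omega>. (X \<omega>)\<^sup>2) = (\<Sum>x\<in>I. \<Sum>y\<in>I. measure_pmf.prob M (B x \<inter> B y))"
    unfolding sq by (auto intro!: ind Bochner_Integration.integrable_sum simp: Bochner_Integration.integral_sum ind)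
  have exp: "(1 - X \<omega> / p)\<^sup>2 = 1 - 2 / p * X \<omega> + 1 / p\<^sup>2 * (X \<omega>)\<^sup>2" for \<omega>
    using p(2) by (simp add: power2_eq_square field_simps)
  have i: "integrable (measure_pmf M) (\<lambda>\<omega>. (1 - X \<omega> / p)\<^sup>2)"
    unfolding exp using X X2 by auto
  have "measure_pmf.prob M {\<omega>. \<forall>x\<in>I. \<omega> \<notin> B x}
      = measure_pmf.expectation M (indicator {\<omega>. \<forall>x\<in>I. \<omega> \<notin> B x})" by simp
  also have "\<dots> \<le> measure_pmf.expectation M (\<lambda>\<omega>. (1 - X \<omega> / p)\<^sup>2)"
    by (intro integral_mono ind i) (auto simp: indicator_def X_def)
  also have "\<dots> = 1 - 2 / p * p + 1 / p\<^sup>2 * (\<Sum>x\<in>I. \<Sum>y\<in>I. measure_pmf.prob M (B x \<inter> B y))"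
    unfolding exp using X X2 by simp
  finally show ?thesis using p(2) by simp
qed

context key_ring_law
begin

lemma expectation_avoid_ge:
  assumes "u \<le> P"
  shows "1 - real u * measure_pmf.expectation \<mu> (\<lambda>i. real (K i)) / real P
     \<le> measure_pmf.expectation \<mu> (\<lambda>i. avoid P u (K i))"
proof -
  have "1 - real u * measure_pmf.expectation \<mu> (\<lambda>i. real (K i)) / real P
      = measure_pmf.expectation \<mu> (\<lambda>i. 1 - real u / real P * real (K i))"
    by (subst Bochner_Integration.integral_diff) (auto intro!: integrable_measure_pmf_finite finite_classes)
  also have "\<dots> \<le> measure_pmf.expectation \<mu> (\<lambda>i. avoid P u (K i))"
    using avoid_ge[OF K_le assms]
    by (intro integral_mono_AE integrable_measure_pmf_finite finite_classes) (auto simp: AE_measure_pmf_iff)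
  finally show ?thesis .
qed

text \<open>
  With \<open>q\<close> the class-dependent probability of avoiding \<open>u\<close> keys, the left side is at most the mean of
  \<open>q\<^sup>2\<close>. It exceeds the square of the mean of \<open>q\<close> by the variance of \<open>1 - q\<close>, and
  \<open>0 \<le> 1 - q \<le> \<delta>\<close>.
\<close>
lemma expectation_avoid_double_le:
  assumes "u \<le> P" and \<delta>: "\<And>i. i \<in> set_pmf \<mu> \<Longrightarrow> real u * real (K i) / real P \<le> \<delta>"
  shows "measure_pmf.expectation \<mu> (\<lambda>i. avoid P (2 * u) (K i))
     \<le> (measure_pmf.expectation \<mu> (\<lambda>i. avoid P u (K i)))\<^sup>2 + \<delta>\<^sup>2"
proof -
  let ?q = "\<lambda>i. avoid P u (K i)"
  let ?h = "measure_pmf.expectation \<mu> ?q"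
  have int: "integrable (measure_pmf \<mu>) f" for f :: "nat \<Rightarrow> real"
    by (intro integrable_measure_pmf_finite finite_classes)
  have "measure_pmf.expectation \<mu> (\<lambda>i. avoid P (2 * u) (K i))
      \<le> measure_pmf.expectation \<mu> (\<lambda>i. 2 * ?q i - 1 + \<delta>\<^sup>2)"
  proof (intro integral_mono_AE int, unfold AE_measure_pmf_iff, intro ballI)
    fix i assume i: "i \<in> set_pmf \<mu>"
    have "avoid P (2 * u) (K i) \<le> (?q i)\<^sup>2" using K_le[OF i] by (rule avoid_double)
    also have "(?q i)\<^sup>2 = 2 * ?q i - 1 + (1 - ?q i)\<^sup>2" by (simp add: power2_eq_square algebra_simps)
    also have "(1 - ?q i)\<^sup>2 \<le> \<delta>\<^sup>2"
      using avoid_ge[OF K_le[OF i] assms(1)] \<delta>[OF i] avoid_le_1[of P u "K i"] by (intro power_mono) auto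
    finally show "avoid P (2 * u) (K i) \<le> 2 * ?q i - 1 + \<delta>\<^sup>2" by simp
  qed
  also have "\<dots> = 2 * ?h - 1 + \<delta>\<^sup>2"
    by (subst Bochner_Integration.integral_add, simp add: int, simp add: int,
        subst Bochner_Integration.integral_diff) (auto simp: int)
  also have "2 * ?h - 1 \<le> ?h\<^sup>2" using zero_le_power2[of "?h - 1"] by (simp add: power2_eq_square algebra_simps)
  finally show ?thesis by simp
qed

text \<open>
  The second moment method for the nodes that are isolated and own exactly \<open>k\<close> keys. Fixing the ring
  size makes the conditional isolation probability the same number \<open>h\<close> for all of them; two such
  nodes have disjoint rings, so the remaining \<open>n - 2\<close> rings have to avoid \<open>2 k\<close> keys.
\<close>
lemma prob_no_isolated_le_second_moment:
  fixes V :: "'v set"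
  assumes V: "finite V" "card V = n" "n \<ge> 2" and "k \<le> P"
    and \<nu>: "\<nu> = measure_pmf.prob D {A. card A = k}" "\<nu> > 0"
    and h: "h = measure_pmf.expectation \<mu> (\<lambda>i. avoid P k (K i))" "h > 0"
  shows "measure_pmf.prob (Pi_pmf V {} (\<lambda>_. D)) {\<Sigma>. \<forall>x\<in>V. \<not> separated V \<Sigma> {x}}
      \<le> 1 / (real n * \<nu> * h ^ (n - 1))
        + measure_pmf.expectation \<mu> (\<lambda>i. avoid P (2 * k) (K i)) ^ (n - 2) / (h ^ (n - 1))\<^sup>2 - 1"
proof -
  let ?M = "Pi_pmf V {} (\<lambda>_. D)"
  define h2 where "h2 = measure_pmf.expectation \<mu> (\<lambda>i. avoid P (2 * k) (K i))"
  define B where "B x = {\<Sigma> :: 'v \<Rightarrow> nat set. card (\<Sigma> x) = k \<and> separated V \<Sigma> {x}}" for x :: 'v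
  define p where "p = (\<Sum>x\<in>V. measure_pmf.prob ?M (B x))"
  have sub: "A \<subseteq> {1..P}" if "A \<in> set_pmf D" for A using that set_key_ring_pmf by auto
  have h2: "h2 \<ge> 0" unfolding h2_def by (rule Bochner_Integration.integral_nonneg) (simp add: avoid_nonneg)
  have PB: "measure_pmf.prob ?M (B x) = \<nu> * h ^ (n - 1)" if "x \<in> V" for x
    unfolding B_def using prob_separated_singleton[OF V(1) that, of D "\<lambda>A. card A = k" h] sub
    by (simp add: miss_key_ring_pmf h \<nu> V)
  have p: "p = real n * \<nu> * h ^ (n - 1)" unfolding p_def using PB V by simp
  have "p > 0" unfolding p using V \<nu> h by auto
  have PBB: "measure_pmf.prob ?M (B x \<inter> B y) \<le> \<nu>\<^sup>2 * h2 ^ (n - 2)" if xy: "x \<in> V" "y \<in> V" "x \<noteq> y" for x y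
  proof -
    let ?R = "\<lambda>\<Sigma>. card (\<Sigma> x) = k \<and> card (\<Sigma> y) = k \<and> \<Sigma> x \<inter> \<Sigma> y = {}"
    have "measure_pmf.prob ?M (B x \<inter> B y) \<le> measure_pmf.prob ?M {\<Sigma>. ?R \<Sigma> \<and> separated V \<Sigma> {x, y}}"
      unfolding B_def separated_def using xy by (intro measure_pmf.finite_measure_mono) auto
    also have "\<dots> \<le> measure_pmf.prob (Pi_pmf {x, y} {} (\<lambda>_. D)) {\<Sigma>. ?R \<Sigma>} * h2 ^ card (V - {x, y})"
    proof (intro prob_separated_le V h2)
      fix f assume f: "\<forall>z\<in>{x, y}. f z \<in> set_pmf D" "?R f"
      then have s: "f x \<subseteq> {1..P}" "f y \<subseteq> {1..P}" using sub by auto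
      then have "card (f x \<union> f y) = 2 * k"
        using f(2) finite_subset[OF s(1)] finite_subset[OF s(2)] by (simp add: card_Un_disjoint)
      then show "miss D (\<Union>z\<in>{x, y}. f z) \<le> h2"
        using s by (simp add: miss_key_ring_pmf h2_def)
    qed (use xy in auto)
    also have "measure_pmf.prob (Pi_pmf {x, y} {} (\<lambda>_. D)) {\<Sigma>. ?R \<Sigma>}
        \<le> measure_pmf.prob (Pi_pmf {x, y} {} (\<lambda>_. D)) (Pi {x, y} (\<lambda>_. {A. card A = k}))"
      by (intro measure_pmf.finite_measure_mono) auto
    also have "\<dots> = \<nu>\<^sup>2" using xy by (simp add: measure_Pi_pmf_Pi \<nu> power2_eq_square)
    also have "card (V - {x, y}) = n - 2" using xy V by (simp add: card_Diff_subset)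
    finally show ?thesis using h2 by (simp add: mult_right_mono)
  qed
  have "measure_pmf.prob ?M {\<Sigma>. \<forall>x\<in>V. \<not> separated V \<Sigma> {x}}
      \<le> measure_pmf.prob ?M {\<Sigma>. \<forall>x\<in>V. \<Sigma> \<notin> B x}"
    unfolding B_def by (intro measure_pmf.finite_measure_mono) auto
  also have "\<dots> \<le> (\<Sum>x\<in>V. \<Sum>y\<in>V. measure_pmf.prob ?M (B x \<inter> B y)) / p\<^sup>2 - 1"
    by (rule second_moment[OF V(1) p_def \<open>p > 0\<close>])
  also have "(\<Sum>x\<in>V. \<Sum>y\<in>V. measure_pmf.prob ?M (B x \<inter> B y)) \<le> p + (real n)\<^sup>2 * (\<nu>\<^sup>2 * h2 ^ (n - 2))"
  proof -
    have "(\<Sum>y\<in>V. measure_pmf.prob ?M (B x \<inter> B y)) \<le> measure_pmf.prob ?M (B x) + real n * (\<nu>\<^sup>2 * h2 ^ (n - 2))"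
      if x: "x \<in> V" for x
    proof -
      have "(\<Sum>y\<in>V. measure_pmf.prob ?M (B x \<inter> B y))
          = measure_pmf.prob ?M (B x) + (\<Sum>y\<in>V - {x}. measure_pmf.prob ?M (B x \<inter> B y))"
        using x V by (subst sum.remove[of V x]) auto
      also have "(\<Sum>y\<in>V - {x}. measure_pmf.prob ?M (B x \<inter> B y)) \<le> (\<Sum>y\<in>V - {x}. \<nu>\<^sup>2 * h2 ^ (n - 2))"
        using PBB x by (intro sum_mono) auto
      also have "\<dots> \<le> (\<Sum>y\<in>V. \<nu>\<^sup>2 * h2 ^ (n - 2))" using h2 V by (intro sum_mono2) auto
      finally show ?thesis using V by simp
    qed
    then have "(\<Sum>x\<in>V. \<Sum>y\<in>V. measure_pmf.prob ?M (B x \<inter> B y))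
       \<le> (\<Sum>x\<in>V. measure_pmf.prob ?M (B x) + real n * (\<nu>\<^sup>2 * h2 ^ (n - 2)))" by (intro sum_mono)
    also have "\<dots> = p + (real n)\<^sup>2 * (\<nu>\<^sup>2 * h2 ^ (n - 2))"
      using V by (simp add: sum.distrib p_def power2_eq_square)
    finally show ?thesis .
  qed
  also have "(p + (real n)\<^sup>2 * (\<nu>\<^sup>2 * h2 ^ (n - 2))) / p\<^sup>2 = 1 / p + h2 ^ (n - 2) / (h ^ (n - 1))\<^sup>2"
    using \<open>p > 0\<close> V \<nu> h unfolding p by (simp add: add_divide_distrib power2_eq_square)
  finally show ?thesis unfolding p h2_def by (simp add: divide_right_mono)
qed

text \<open>
  This is only an inequality because several classes may share the ring size \<open>k\<close>.
\<close>
lemma prob_card_ge_pmf: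
  assumes "j \<in> set_pmf \<mu>" "K j = k"
  shows "pmf \<mu> j \<le> measure_pmf.prob D {A. card A = k}"
proof -
  have "pmf \<mu> j = measure_pmf.expectation \<mu> (indicator {j})" by (simp add: measure_pmf_single)
  also have "\<dots> \<le> measure_pmf.expectation \<mu>
     (\<lambda>i. real (card ({S. S \<subseteq> {1..P} \<and> card S = K i} \<inter> {A. card A = k})) / real (P choose K i))"
  proof (intro integral_mono integrable_measure_pmf_finite finite_classes)
    fix i
    show "indicator {j} i \<le> real (card ({S. S \<subseteq> {1..P} \<and> card S = K i} \<inter> {A. card A = k})) / real (P choose K i)"
    proof (cases "i = j")
      case True
      have "{S. S \<subseteq> {1..P} \<and> card S = K j} \<inter> {A. card A = k} = {S. S \<subseteq> {1..P} \<and> card S = K j}"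
        using assms by auto
      then show ?thesis using True K_le[OF assms(1)] by (simp add: key_rings_of_size[simplified])
    qed simp
  qed
  also have "\<dots> = measure_pmf.prob D {A. card A = k}" by (rule prob_key_ring_pmf [symmetric])
  finally show ?thesis .
qed

text \<open>
  An explicit form of the preceding bound in terms of the load \<open>A = k E|\<Sigma>| / P\<close>. It uses
  \<open>h \<ge> 1 - A \<ge> exp(- A - 2 A\<^sup>2)\<close>; the first summand is the inverse of a lower bound for the mean number
  of the counted nodes, the second one compares the joint probabilities with the product.
\<close>
lemma prob_no_isolated_le:
  fixes V :: "'v set"
  assumes V: "finite V" "card V = n" "n \<ge> 2"
    and j: "j \<in> set_pmf \<mu>" "K j = k"
    and A: "A = real k * measure_pmf.expectation \<mu> (\<lambda>i. real (K i)) / real P" "A \<le> 1 / 2"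
    and \<delta>: "\<And>i. i \<in> set_pmf \<mu> \<Longrightarrow> real k * real (K i) / real P \<le> \<delta>"
  shows "measure_pmf.prob (Pi_pmf V {} (\<lambda>_. D)) {\<Sigma>. \<forall>x\<in>V. \<not> separated V \<Sigma> {x}}
      \<le> exp (real n * (A + 2 * A\<^sup>2)) / (real n * pmf \<mu> j) + exp (4 * real n * \<delta>\<^sup>2 + 2 * (A + 2 * A\<^sup>2)) - 1"
proof -
  define h where "h = measure_pmf.expectation \<mu> (\<lambda>i. avoid P k (K i))"
  define h2 where "h2 = measure_pmf.expectation \<mu> (\<lambda>i. avoid P (2 * k) (K i))"
  define \<nu> where "\<nu> = measure_pmf.prob D {A. card A = k}"
  have "k \<le> P" using K_le[OF j(1)] j by simp
  have \<nu>: "0 < pmf \<mu> j" "pmf \<mu> j \<le> \<nu>" 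
    using j prob_card_ge_pmf[OF j] by (auto simp: \<nu>_def pmf_positive)
  have A0: "0 \<le> A" unfolding A by (auto intro!: divide_nonneg_nonneg mult_nonneg_nonneg Bochner_Integration.integral_nonneg)
  have hA: "1 - A \<le> h" using expectation_avoid_ge[OF \<open>k \<le> P\<close>] unfolding h_def A by simp
  then have h: "1 / 2 \<le> h" using A(2) by linarith
  define b where "b = A + 2 * A\<^sup>2"
  have b0: "0 \<le> b" using A0 by (simp add: b_def)
  have "exp (- b) \<le> 1 - A"
    using ln_one_minus_pos_lower_bound[of A] A0 A(2) by (simp add: b_def ln_ge_iff)
  then have hb: "exp (- b) \<le> h" using hA by simp
  have hpow: "exp (- (real i * b)) \<le> h ^ i" for i
    using power_mono[OF hb, of i] by (simp add: exp_of_nat_mult [symmetric])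
  have h2: "0 \<le> h2" unfolding h2_def by (rule Bochner_Integration.integral_nonneg) (simp add: avoid_nonneg)
  have "h2 \<le> h\<^sup>2 + \<delta>\<^sup>2"
    unfolding h_def h2_def by (rule expectation_avoid_double_le[OF \<open>k \<le> P\<close> \<delta>])
  also have "\<dots> \<le> h\<^sup>2 * (1 + 4 * \<delta>\<^sup>2)"
  proof -
    have "(1 / 2)\<^sup>2 \<le> h\<^sup>2" using h by (intro power_mono) auto
    then have "1 * \<delta>\<^sup>2 \<le> (4 * h\<^sup>2) * \<delta>\<^sup>2" by (intro mult_right_mono) (auto simp: power2_eq_square)
    then show ?thesis by (simp add: algebra_simps)
  qed
  also have "\<dots> \<le> h\<^sup>2 * exp (4 * \<delta>\<^sup>2)"
    using exp_ge_add_one_self[of "4 * \<delta>\<^sup>2"] by (intro mult_left_mono) auto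
  finally have "h2 ^ (n - 2) \<le> (h\<^sup>2 * exp (4 * \<delta>\<^sup>2)) ^ (n - 2)" using h2 by (intro power_mono)
  also have "\<dots> = (h ^ (n - 2))\<^sup>2 * exp (real (n - 2) * (4 * \<delta>\<^sup>2))"
    by (simp add: power_mult_distrib exp_of_nat_mult power_mult [symmetric] mult.commute)
  also have "\<dots> \<le> (h ^ (n - 2))\<^sup>2 * exp (real n * (4 * \<delta>\<^sup>2))"
    by (intro mult_left_mono) (auto intro!: mult_right_mono)
  finally have 1: "h2 ^ (n - 2) / (h ^ (n - 1))\<^sup>2 \<le> (h ^ (n - 2))\<^sup>2 * exp (real n * (4 * \<delta>\<^sup>2)) / (h ^ (n - 1))\<^sup>2"
    by (intro divide_right_mono) auto
  have "h ^ (n - 1) = h * h ^ (n - 2)" using V(3) by (metis Suc_1 Suc_diff_Suc Suc_le_lessD power_Suc)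
  then have "(h ^ (n - 2))\<^sup>2 * exp (real n * (4 * \<delta>\<^sup>2)) / (h ^ (n - 1))\<^sup>2 = exp (real n * (4 * \<delta>\<^sup>2)) / h\<^sup>2"
    using h by (simp add: power_mult_distrib)
  also have "\<dots> \<le> exp (real n * (4 * \<delta>\<^sup>2)) / exp (- (real 2 * b))"
    using hpow[of 2] h by (intro divide_left_mono) auto
  also have "\<dots> = exp (4 * real n * \<delta>\<^sup>2 + 2 * b)"
    by (simp add: exp_diff [symmetric] mult_ac)
  finally have 2: "h2 ^ (n - 2) / (h ^ (n - 1))\<^sup>2 \<le> exp (4 * real n * \<delta>\<^sup>2 + 2 * b)" using 1 by simp
  have "exp (- (real n * b)) \<le> exp (- (real (n - 1) * b))" using b0 by (auto intro!: mult_right_mono)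
  also note hpow[of "n - 1"]
  finally have "real n * pmf \<mu> j * exp (- (real n * b)) \<le> real n * \<nu> * h ^ (n - 1)"
    using \<nu> h by (intro mult_mono) auto
  then have "1 / (real n * \<nu> * h ^ (n - 1)) \<le> 1 / (real n * pmf \<mu> j * exp (- (real n * b)))"
    using \<nu> h V by (intro divide_left_mono) auto
  also have "\<dots> = exp (real n * b) / (real n * pmf \<mu> j)" by (simp add: exp_minus field_simps)
  finally have 3: "1 / (real n * \<nu> * h ^ (n - 1)) \<le> exp (real n * b) / (real n * pmf \<mu> j)" .
  have "measure_pmf.prob (Pi_pmf V {} (\<lambda>_. D)) {\<Sigma>. \<forall>x\<in>V. \<not> separated V \<Sigma> {x}}
      \<le> 1 / (real n * \<nu> * h ^ (n - 1)) + h2 ^ (n - 2) / (h ^ (n - 1))\<^sup>2 - 1"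
    unfolding h2_def
    by (rule prob_no_isolated_le_second_moment[OF V \<open>k \<le> P\<close> \<nu>_def _ h_def]) (use \<nu> h in auto)
  with 2 3 show ?thesis unfolding b_def by linarith
qed

end

section \<open>The Laplace transform of the key ring size\<close>

text \<open>
  Since \<open>1 + y + y\<^sup>2 / 2 \<le> exp y\<close>, it is enough that \<open>(1 - y + y\<^sup>2 / 2) (1 + y + y\<^sup>2 / 2) = 1 + y ^ 4 / 4\<close>
  is at least \<open>1\<close>.
\<close>
lemma exp_minus_le_quadratic:
  fixes y :: real assumes "y \<ge> 0" shows "exp (- y) \<le> 1 - y + y\<^sup>2 / 2"
proof -
  have "1 \<le> (1 - y + y\<^sup>2 / 2) * (1 + y + y\<^sup>2 / 2)"
  proof -
    have "(1 - y + y\<^sup>2 / 2) * (1 + y + y\<^sup>2 / 2) = 1 + y ^ 4 / 4"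
      by (simp add: algebra_simps power2_eq_square power4_eq_xxxx)
    then show ?thesis by simp
  qed
  also have "\<dots> \<le> (1 - y + y\<^sup>2 / 2) * exp y"
  proof (intro mult_left_mono)
    show "1 + y + y\<^sup>2 / 2 \<le> exp y" using exp_lower_Taylor_quadratic[OF assms] .
    have "1 - y + y\<^sup>2 / 2 = ((1 - y)\<^sup>2 + 1) / 2" by (simp add: power2_eq_square field_simps)
    then show "0 \<le> 1 - y + y\<^sup>2 / 2" by (simp only:) simp
  qed
  finally show ?thesis by (simp add: exp_minus field_simps)
qed

context key_ring_law
begin

definition laplace :: "real \<Rightarrow> real" where
  "laplace a = measure_pmf.expectation \<mu> (\<lambda>i. exp (- (a * real (K i) / real P)))"

lemma laplace_nonneg: "0 \<le> laplace a" unfolding laplace_def by (rule Bochner_Integration.integral_nonneg) auto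

text \<open>
  Three estimates for the Laplace transform are used. The first one is sharp up to the factor
  \<open>1 - \<delta> / 2\<close> as long as all exponents are at most \<open>\<delta>\<close>.
\<close>
lemma laplace_le_mean:
  assumes "a \<ge> 0" "\<And>i. i \<in> set_pmf \<mu> \<Longrightarrow> a * real (K i) / real P \<le> \<delta>"
  shows "laplace a \<le> exp (- ((1 - \<delta> / 2) * (a * measure_pmf.expectation \<mu> (\<lambda>i. real (K i)) / real P)))"
proof -
  have "laplace a \<le> measure_pmf.expectation \<mu> (\<lambda>i. 1 - (1 - \<delta> / 2) * (a / real P) * real (K i))"
    unfolding laplace_def
  proof (intro integral_mono_AE integrable_measure_pmf_finite finite_classes, unfold AE_measure_pmf_iff, intro ballI)
    fix i assume i: "i \<in> set_pmf \<mu>"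
    define y where "y = a * real (K i) / real P"
    have y: "0 \<le> y" "y \<le> \<delta>" using assms i by (auto simp: y_def)
    have "exp (- y) \<le> 1 - y + y\<^sup>2 / 2" by (rule exp_minus_le_quadratic) fact
    also have "y\<^sup>2 \<le> \<delta> * y" unfolding power2_eq_square using y by (intro mult_right_mono)
    finally have "exp (- y) \<le> 1 - (1 - \<delta> / 2) * y" by (simp add: algebra_simps)
    then show "exp (- (a * real (K i) / real P)) \<le> 1 - (1 - \<delta> / 2) * (a / real P) * real (K i)"
      by (simp add: y_def)
  qed
  also have "\<dots> = 1 - (1 - \<delta> / 2) * (a * measure_pmf.expectation \<mu> (\<lambda>i. real (K i)) / real P)"
    by (subst Bochner_Integration.integral_diff) (auto intro!: integrable_measure_pmf_finite finite_classes)
  also have "\<dots> \<le> exp (- ((1 - \<delta> / 2) * (a * measure_pmf.expectation \<mu> (\<lambda>i. real (K i)) / real P)))"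
    using exp_ge_add_one_self[of "- ((1 - \<delta> / 2) * (a * measure_pmf.expectation \<mu> (\<lambda>i. real (K i)) / real P))"] by simp
  finally show ?thesis .
qed

text \<open>
  If the exponent of a single class is not small, that class alone keeps the transform away
  from \<open>1\<close>.
\<close>
lemma laplace_le_class:
  assumes "a \<ge> 0" "\<delta> \<le> a * real (K j) / real P" 
  shows "laplace a \<le> exp (- (pmf \<mu> j * (1 - exp (- \<delta>))))"
proof -
  have "laplace a \<le> measure_pmf.expectation \<mu> (\<lambda>i. 1 - (1 - exp (- \<delta>)) * indicator {j} i)"
    unfolding laplace_def using assms
    by (intro integral_mono_AE integrable_measure_pmf_finite finite_classes, unfold AE_measure_pmf_iff)
       (auto simp: indicator_def)
  also have "\<dots> = 1 - pmf \<mu> j * (1 - exp (- \<delta>))"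
    by (subst Bochner_Integration.integral_diff) (auto intro!: integrable_measure_pmf_finite finite_classes simp: measure_pmf_single)
  also have "\<dots> \<le> exp (- (pmf \<mu> j * (1 - exp (- \<delta>))))"
    using exp_ge_add_one_self[of "- (pmf \<mu> j * (1 - exp (- \<delta>)))"] by simp
  finally show ?thesis .
qed

text \<open>
  This bound, from the smallest possible ring size, makes the transform small for large \<open>a\<close>.
\<close>
lemma laplace_le_min:
  assumes "a \<ge> 0" shows "laplace a \<le> exp (- (a * real k / real P))"
proof -
  have "laplace a \<le> measure_pmf.expectation \<mu> (\<lambda>i. exp (- (a * real k / real P)))"
    unfolding laplace_def using assms k_le
    by (intro integral_mono_AE integrable_measure_pmf_finite finite_classes, unfold AE_measure_pmf_iff)
       (auto intro!: divide_right_mono mult_left_mono)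
  then show ?thesis by simp
qed

lemma laplace_le_1: assumes "a \<ge> 0" shows "laplace a \<le> 1"
proof -
  have "exp (- (a * real k / real P)) \<le> 1" using assms by simp
  then show ?thesis using laplace_le_min[OF assms] by linarith
qed

end

section \<open>A union bound for cuts\<close>

lemma sum_over_subsets_le:
  fixes M :: "'a pmf"
  assumes "finite V" "finite I" and f: "\<And>s S. s \<in> I \<Longrightarrow> S \<subseteq> V \<Longrightarrow> card S = s \<Longrightarrow> measure_pmf.prob M (E S) \<le> f s"
  shows "measure_pmf.prob M (\<Union>S\<in>{S. S \<subseteq> V \<and> card S \<in> I}. E S) \<le> (\<Sum>s\<in>I. real (card V choose s) * f s)"
proof -
  have fin: "finite {S. S \<subseteq> V \<and> card S \<in> I}" using assms(1) by simp
  have "measure_pmf.prob M (\<Union>S\<in>{S. S \<subseteq> V \<and> card S \<in> I}. E S)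
      \<le> (\<Sum>S\<in>{S. S \<subseteq> V \<and> card S \<in> I}. measure_pmf.prob M (E S))"
    by (intro measure_pmf.finite_measure_subadditive_finite fin) auto
  also have "\<dots> \<le> (\<Sum>S\<in>{S. S \<subseteq> V \<and> card S \<in> I}. f (card S))"
    by (intro sum_mono f) auto
  also have "\<dots> = (\<Sum>s\<in>I. \<Sum>S\<in>{S \<in> {S. S \<subseteq> V \<and> card S \<in> I}. card S = s}. f (card S))"
    by (intro sum.group[symmetric] fin assms) auto
  also have "\<dots> = (\<Sum>s\<in>I. real (card V choose s) * f s)"
  proof (intro sum.cong refl)
    fix s assume "s \<in> I"
    then have "{S \<in> {S. S \<subseteq> V \<and> card S \<in> I}. card S = s} = {S. S \<subseteq> V \<and> card S = s}" by auto
    then show "(\<Sum>S\<in>{S \<in> {S. S \<subseteq> V \<and> card S \<in> I}. card S = s}. f (card S)) = real (card V choose s) * f s"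
      using n_subsets[OF assms(1), of s] by simp
  qed
  finally show ?thesis .
qed

context key_ring_law
begin

lemma D_ring: "A \<in> set_pmf D \<Longrightarrow> A \<subseteq> {1..P} \<and> k \<le> card A"
  using set_key_ring_pmf k_le by auto

text \<open>
  If the union is smaller than \<open>b = \<theta> s k\<close>, it lies in some set \<open>T\<close> of \<open>\<lfloor>b\<rfloor>\<close> keys. A union
  bound over \<open>T\<close> costs \<open>C(P, b) \<le> (e P / b) ^ b\<close>, whereas all \<open>s\<close> rings lie in \<open>T\<close> with
  probability at most \<open>(b / P) ^ (s k)\<close>; what remains is a power \<open>(1 - \<theta>) s k\<close> of the
  fraction \<open>b / P\<close>.
\<close>
lemma prob_small_union_le:
  assumes V: "finite V" "S \<subseteq> V" "card S = s" and lam: "0 < \<theta>" "\<theta> < 1"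
    and s: "s > 0" and b: "\<theta> * real s * real k \<le> real P"
  shows "measure_pmf.prob (Pi_pmf V {} (\<lambda>_. D)) {\<Sigma>. real (card (\<Union>x\<in>S. \<Sigma> x)) < \<theta> * real s * real k}
      \<le> exp (real s * real k * (\<theta> + (1 - \<theta>) * ln (\<theta> * real s * real k / real P)))"
proof -
  let ?M = "Pi_pmf V {} (\<lambda>_. D)"
  define b where "b = \<theta> * real s * real k"
  define x where "x = nat \<lfloor>b\<rfloor>"
  have b0: "0 < b" "b \<le> real P" "b \<le> real s * real k"
    unfolding b_def using lam s k_pos assms(7) by (auto simp: mult_le_cancel_right1)
  have xb: "real x \<le> b" using b0 by (simp add: x_def)
  then have xP: "x \<le> P" using b0 by linarith
  have fS: "finite S" using V finite_subset by auto
  have "measure_pmf.prob ?M {\<Sigma>. real (card (\<Union>x\<in>S. \<Sigma> x)) < b}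
     \<le> measure_pmf.prob ?M (\<Union>T\<in>{T. T \<subseteq> {1..P} \<and> card T \<in> {x}}. {\<Sigma>. \<forall>y\<in>S. \<Sigma> y \<subseteq> T})"
  proof (intro measure_pmf.finite_measure_mono_AE, unfold AE_measure_pmf_iff, intro ballI impI)
    fix \<Sigma> assume S: "\<Sigma> \<in> set_pmf ?M" "\<Sigma> \<in> {\<Sigma>. real (card (\<Union>x\<in>S. \<Sigma> x)) < b}"
    have sub: "(\<Union>x\<in>S. \<Sigma> x) \<subseteq> {1..P}"
      using S(1) set_Pi_pmf_subset'[OF V(1), of "{}" "\<lambda>_. D"] V(2) D_ring
      by (fastforce simp: PiE_dflt_def)
    have "card (\<Union>x\<in>S. \<Sigma> x) \<le> x" using S(2) unfolding x_def by (simp add: le_nat_floor)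
    then obtain T where "(\<Union>x\<in>S. \<Sigma> x) \<subseteq> T" "T \<subseteq> {1..P}" "card T = x"
      using exists_subset_between[of "\<Union>x\<in>S. \<Sigma> x" x "{1..P}"] xP sub by auto
    then show "\<Sigma> \<in> (\<Union>T\<in>{T. T \<subseteq> {1..P} \<and> card T \<in> {x}}. {\<Sigma>. \<forall>y\<in>S. \<Sigma> y \<subseteq> T})" by blast
  qed simp
  also have "\<dots> \<le> (\<Sum>t\<in>{x}. real (card {1..P} choose t) * (real t / real P) ^ (k * s))"
  proof (intro sum_over_subsets_le)
    fix t T assume "t \<in> {x}" and T: "T \<subseteq> {1..P}" "card T = t"
    have "{\<Sigma>. \<forall>y\<in>S. \<Sigma> y \<subseteq> T} = Pi V (\<lambda>y. if y \<in> S then {A. A \<subseteq> T} else UNIV)"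
    proof (intro equalityI subsetI)
      fix \<Sigma> assume *: "\<Sigma> \<in> Pi V (\<lambda>y. if y \<in> S then {A. A \<subseteq> T} else UNIV)"
      have "\<Sigma> y \<subseteq> T" if "y \<in> S" for y using Pi_mem[OF *, of y] that V(2) by auto
      then show "\<Sigma> \<in> {\<Sigma>. \<forall>y\<in>S. \<Sigma> y \<subseteq> T}" by blast
    qed auto
    then have "measure_pmf.prob ?M {\<Sigma>. \<forall>y\<in>S. \<Sigma> y \<subseteq> T}
        = (\<Prod>y\<in>V. if y \<in> S then measure_pmf.prob D {A. A \<subseteq> T} else 1)"
      using V(1) by (simp add: measure_Pi_pmf_Pi if_distrib cong: if_cong)
    also have "\<dots> = measure_pmf.prob D {A. A \<subseteq> T} ^ s"
      using V by (simp add: prod.If_cases Int_absorb1)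
    also have "\<dots> \<le> ((real (card T) / real P) ^ k) ^ s"
      using prob_key_ring_subset_le[OF T(1)] by (intro power_mono) auto
    finally show "measure_pmf.prob ?M {\<Sigma>. \<forall>y\<in>S. \<Sigma> y \<subseteq> T} \<le> (real t / real P) ^ (k * s)"
      by (simp add: T power_mult)
  qed auto
  also have "\<dots> = real (P choose x) * (real x / real P) ^ (k * s)" by simp
  also have "\<dots> \<le> exp (b + (real s * real k - b) * ln (b / real P))"
  proof (cases "x = 0")
    case True
    then show ?thesis using k_pos s by (simp add: power_0_left)
  next
    case False
    have pow: "(real x / real P) ^ (k * s) = exp (real (k * s) * ln (real x / real P))"
      using False P_pos by (subst exp_of_nat_mult) simp
    have "real (P choose x) * (real x / real P) ^ (k * s)
       \<le> exp (real x * (1 + ln (real P / real x))) * exp (real (k * s) * ln (real x / real P))"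
      unfolding pow using False xP by (intro mult_right_mono binomial_le_exp) auto
    also have "\<dots> = exp (real x + (real s * real k - real x) * ln (real x / real P))"
      using False P_pos by (simp add: ln_div algebra_simps flip: exp_add)
    also have "\<dots> \<le> exp (b + (real s * real k - b) * ln (b / real P))"
    proof -
      have l: "ln (real x / real P) \<le> ln (b / real P)" "ln (b / real P) \<le> 0"
        using False xb P_pos b0 by (auto intro!: divide_right_mono)
      have "(real s * real k - real x) * ln (real x / real P) \<le> (real s * real k - real x) * ln (b / real P)"
        using l xb b0 by (intro mult_left_mono) auto
      also have "\<dots> \<le> (real s * real k - b) * ln (b / real P)"
        using l xb by (intro mult_right_mono_neg) auto
      finally show ?thesis using xb by simp
    qed
    finally show ?thesis .
  qed
  also have "b + (real s * real k - b) * ln (b / real P) = real s * real k * (\<theta> + (1 - \<theta>) * ln (\<theta> * real s * real k / real P))"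
    by (simp add: b_def algebra_simps)
  finally show ?thesis unfolding b_def .
qed

lemma prob_separated_large_union_le:
  assumes V: "finite V" "S \<subseteq> V" and "a \<ge> 0"
  shows "measure_pmf.prob (Pi_pmf V {} (\<lambda>_. D)) {\<Sigma>. a \<le> real (card (\<Union>x\<in>S. \<Sigma> x)) \<and> separated V \<Sigma> S}
      \<le> laplace a ^ (card V - card S)"
proof -
  have fS: "finite S" using V finite_subset by auto
  have "measure_pmf.prob (Pi_pmf V {} (\<lambda>_. D)) {\<Sigma>. a \<le> real (card (\<Union>x\<in>S. \<Sigma> x)) \<and> separated V \<Sigma> S}
     \<le> measure_pmf.prob (Pi_pmf S {} (\<lambda>_. D)) {\<Sigma>. a \<le> real (card (\<Union>x\<in>S. \<Sigma> x))} * laplace a ^ card (V - S)"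
  proof (intro prob_separated_le V laplace_nonneg)
    fix f :: "'a \<Rightarrow> nat set" assume f: "\<forall>x\<in>S. f x \<in> set_pmf D" "a \<le> real (card (\<Union>x\<in>S. f x))"
    then have "(\<Union>x\<in>S. f x) \<subseteq> {1..P}" using D_ring by blast
    then show "miss D (\<Union>x\<in>S. f x) \<le> laplace a"
      unfolding laplace_def using f(2) by (intro miss_le_exp)
  next
    fix f g :: "'a \<Rightarrow> nat set" assume "\<forall>x\<in>S. f x = g x"
    then have "(\<Union>x\<in>S. f x) = (\<Union>x\<in>S. g x)" by auto
    then show "(a \<le> real (card (\<Union>x\<in>S. f x))) = (a \<le> real (card (\<Union>x\<in>S. g x)))" by simp
  qed
  also have "\<dots> \<le> 1 * laplace a ^ card (V - S)"
    by (intro mult_right_mono) (auto simp: laplace_nonneg)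
  finally show ?thesis using V fS by (simp add: card_Diff_subset)
qed

text \<open>
  Either some set of at most \<open>m\<close> nodes has a small union of rings, or a cut \<open>S\<close> of at most \<open>m\<close> nodes has
  a large union, or a cut \<open>S\<close> with more than \<open>m\<close> nodes contains \<open>m\<close> nodes whose union is already large.
  The three summands are the union bounds for these cases; the exponent \<open>n div 2\<close> bounds the
  number \<open>n - s\<close> of outside nodes from below.
\<close>
lemma prob_cut_le:
  assumes V: "finite V" "card V = n" and lam: "0 < \<theta>" "\<theta> < 1" 
    and m: "m \<ge> 1" and b: "\<theta> * real m * real k \<le> real P"
  shows "measure_pmf.prob (Pi_pmf V {} (\<lambda>_. D)) {\<Sigma>. \<exists>S\<subseteq>V. S \<noteq> {} \<and> 2 * card S \<le> n \<and> separated V \<Sigma> S}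
    \<le> (\<Sum>s\<in>{1..m}. real (n choose s) *
           exp (real s * real k * (\<theta> + (1 - \<theta>) * ln (\<theta> * real s * real k / real P))))
     + (\<Sum>s\<in>{1..m}. real (n choose s) * laplace (\<theta> * real s * real k) ^ (n - s))
     + 2 ^ n * laplace (\<theta> * real m * real k) ^ (n div 2)"
proof -
  let ?M = "Pi_pmf V {} (\<lambda>_. D)" and ?I = "{s. m < s \<and> 2 * s \<le> n}"
  define small where "small S = {\<Sigma> :: 'a \<Rightarrow> nat set. real (card (\<Union>x\<in>S. \<Sigma> x)) < \<theta> * real (card S) * real k}" for S :: "'a set"
  define cut where "cut a S = {\<Sigma> :: 'a \<Rightarrow> nat set. a \<le> real (card (\<Union>x\<in>S. \<Sigma> x)) \<and> separated V \<Sigma> S}" for a and S :: "'a set"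
  let ?E1 = "\<Union>S\<in>{S. S \<subseteq> V \<and> card S \<in> {1..m}}. small S"
  let ?E2 = "\<Union>S\<in>{S. S \<subseteq> V \<and> card S \<in> {1..m}}. cut (\<theta> * real (card S) * real k) S"
  let ?E3 = "\<Union>S\<in>{S. S \<subseteq> V \<and> card S \<in> ?I}. cut (\<theta> * real m * real k) S"
  have finI: "finite ?I" by (rule finite_subset[of _ "{..n}"]) auto
  have a0: "0 \<le> \<theta> * real s * real k" for s using lam by simp
  have "measure_pmf.prob ?M {\<Sigma>. \<exists>S\<subseteq>V. S \<noteq> {} \<and> 2 * card S \<le> n \<and> separated V \<Sigma> S}
      \<le> measure_pmf.prob ?M (?E1 \<union> ?E2 \<union> ?E3)"
  proof (intro measure_pmf.finite_measure_mono_AE, unfold AE_measure_pmf_iff, intro ballI impI)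
    fix \<Sigma> assume \<Sigma>: "\<Sigma> \<in> set_pmf ?M" "\<Sigma> \<in> {\<Sigma>. \<exists>S\<subseteq>V. S \<noteq> {} \<and> 2 * card S \<le> n \<and> separated V \<Sigma> S}"
    then obtain S where S: "S \<subseteq> V" "S \<noteq> {}" "2 * card S \<le> n" "separated V \<Sigma> S" by blast
    have fS: "finite S" using S V finite_subset by auto
    have sub: "\<Sigma> x \<subseteq> {1..P}" if "x \<in> V" for x
      using \<Sigma>(1) set_Pi_pmf_subset'[OF V(1), of "{}" "\<lambda>_. D"] that D_ring
      by (fastforce simp: PiE_dflt_def)
    then have finU: "finite (\<Union>x\<in>S. \<Sigma> x)" using S fS by (meson finite_UN finite_atLeastAtMost finite_subset subsetD)
    show "\<Sigma> \<in> ?E1 \<union> ?E2 \<union> ?E3"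
    proof (cases "card S \<le> m")
      case True
      then have "card S \<in> {1..m}" using S fS by (auto simp: Suc_le_eq card_gt_0_iff)
      moreover have "\<Sigma> \<in> small S \<or> \<Sigma> \<in> cut (\<theta> * real (card S) * real k) S"
        using S unfolding small_def cut_def by auto
      ultimately show ?thesis using S by blast
    next
      case False
      then obtain S' where S': "S' \<subseteq> S" "card S' = m" using obtain_subset_with_card_n[of m S] by auto
      have "card (\<Union>x\<in>S'. \<Sigma> x) \<le> card (\<Union>x\<in>S. \<Sigma> x)" using S' finU by (intro card_mono) auto
      then have "\<Sigma> \<in> small S' \<or> \<Sigma> \<in> cut (\<theta> * real m * real k) S"
        using S S' unfolding small_def cut_def by auto
      moreover have "card S' \<in> {1..m}" "S' \<subseteq> V" using S S' m by auto
      moreover have "card S \<in> ?I" using False S by auto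
      ultimately show ?thesis using S by blast
    qed
  qed simp
  also have "\<dots> \<le> measure_pmf.prob ?M ?E1 + measure_pmf.prob ?M ?E2 + measure_pmf.prob ?M ?E3"
    using measure_Un_le[where M = "measure_pmf ?M" and A = "?E1 \<union> ?E2" and B = ?E3]
      measure_Un_le[where M = "measure_pmf ?M" and A = ?E1 and B = ?E2] by simp
  also have "measure_pmf.prob ?M ?E1 \<le> (\<Sum>s\<in>{1..m}. real (card V choose s) *
           exp (real s * real k * (\<theta> + (1 - \<theta>) * ln (\<theta> * real s * real k / real P))))"
  proof (intro sum_over_subsets_le V)
    fix s S assume s: "s \<in> {1..m}" "S \<subseteq> V" "card S = s"
    have "\<theta> * real s * real k \<le> \<theta> * real m * real k" using s lam by (intro mult_right_mono mult_left_mono) auto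
    then have "\<theta> * real s * real k \<le> real P" using b by linarith
    then show "measure_pmf.prob ?M (small S) \<le> exp (real s * real k * (\<theta> + (1 - \<theta>) * ln (\<theta> * real s * real k / real P)))"
      unfolding small_def using prob_small_union_le[OF V(1) s(2,3) lam] s by simp
  qed auto
  also have "measure_pmf.prob ?M ?E2 \<le> (\<Sum>s\<in>{1..m}. real (card V choose s) * laplace (\<theta> * real s * real k) ^ (n - s))"
  proof (intro sum_over_subsets_le V)
    fix s S assume s: "s \<in> {1..m}" "S \<subseteq> V" "card S = s"
    then show "measure_pmf.prob ?M (cut (\<theta> * real (card S) * real k) S) \<le> laplace (\<theta> * real s * real k) ^ (n - s)"
      unfolding cut_def using prob_separated_large_union_le[OF V(1) s(2) a0, of s] V by simp
  qed auto
  also have "measure_pmf.prob ?M ?E3 \<le> (\<Sum>s\<in>?I. real (card V choose s) * laplace (\<theta> * real m * real k) ^ (n div 2))"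
  proof (intro sum_over_subsets_le V finI)
    fix s S assume s: "s \<in> ?I" "S \<subseteq> V" "card S = s"
    have "measure_pmf.prob ?M (cut (\<theta> * real m * real k) S) \<le> laplace (\<theta> * real m * real k) ^ (n - s)"
      unfolding cut_def using prob_separated_large_union_le[OF V(1) s(2) a0, of m] V s by simp
    also have "\<dots> \<le> laplace (\<theta> * real m * real k) ^ (n div 2)"
      using s by (intro power_decreasing laplace_nonneg laplace_le_1 a0) auto
    finally show "measure_pmf.prob ?M (cut (\<theta> * real m * real k) S) \<le> laplace (\<theta> * real m * real k) ^ (n div 2)" .
  qed
  also have "(\<Sum>s\<in>?I. real (card V choose s) * laplace (\<theta> * real m * real k) ^ (n div 2))
      = real (\<Sum>s\<in>?I. n choose s) * laplace (\<theta> * real m * real k) ^ (n div 2)"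
    by (simp add: V sum_distrib_right)
  also have "\<dots> \<le> 2 ^ n * laplace (\<theta> * real m * real k) ^ (n div 2)"
  proof (intro mult_right_mono zero_le_power laplace_nonneg)
    have "(\<Sum>s\<in>?I. n choose s) \<le> (\<Sum>s\<le>n. n choose s)" by (intro sum_mono2) auto
    then have "(\<Sum>s\<in>?I. n choose s) \<le> 2 ^ n" by (simp add: choose_row_sum)
    then show "real (\<Sum>s\<in>?I. n choose s) \<le> 2 ^ n" by (metis of_nat_le_iff of_nat_power of_nat_numeral)
  qed
  finally show ?thesis by (simp add: V)
qed

end

lemma geometric_sum_le:
  fixes x :: real assumes "0 \<le> x" "x \<le> 1 / 2"
  shows "(\<Sum>s\<in>{1..m}. x ^ s) \<le> 2 * x"
proof -
  have "(\<Sum>s\<in>{1..m}. x ^ s) \<le> 2 * x - 2 * x ^ Suc m"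
  proof (induction m)
    case (Suc m)
    have "2 * x ^ Suc (Suc m) \<le> x ^ Suc m"
      using mult_right_mono[of "2 * x" 1 "x ^ Suc m"] assms by simp
    then show ?case using Suc by simp
  qed simp
  then show ?thesis using assms by (smt (verit) zero_le_power)
qed

context key_ring_law
begin

text \<open>
  Together with \<open>C(n, s) \<le> exp(s (1 + ln (n / s)))\<close>, the summand is at most \<open>exp(s G(s))\<close>, where \<open>G\<close>
  depends on \<open>s\<close> through \<open>(k (1 - \<theta>) - 1) ln s\<close> only. Hence \<open>G\<close> is increasing, its value at \<open>s = n t\<close>
  is a common upper bound, and a geometric series remains.
\<close>
lemma small_union_sum_le:
  assumes n: "n \<ge> 1" and \<theta>: "0 < \<theta>" "\<theta> < 1" "1 \<le> real k * (1 - \<theta>)" and t: "0 < t" "t \<le> 1"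
    and m: "real m \<le> real n * t"
    and g: "1 - ln t + real k * (\<theta> + (1 - \<theta>) * ln (\<theta> * (real n * t) * real k / real P)) \<le> g" "g \<le> - 1"
  shows "(\<Sum>s\<in>{1..m}. real (n choose s) *
           exp (real s * real k * (\<theta> + (1 - \<theta>) * ln (\<theta> * real s * real k / real P)))) \<le> 2 * exp g"
proof -
  have "(\<Sum>s\<in>{1..m}. real (n choose s) *
           exp (real s * real k * (\<theta> + (1 - \<theta>) * ln (\<theta> * real s * real k / real P))))
      \<le> (\<Sum>s\<in>{1..m}. exp g ^ s)"
  proof (intro sum_mono)
    fix s assume s: "s \<in> {1..m}"
    have "real s \<le> real n * t" using s m by (auto intro: order.trans[OF _ m])
    moreover have "real n * t \<le> real n" using t by (simp add: mult_left_le)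
    ultimately have sn: "s \<le> n" by linarith
    have pos: "0 < real s" "0 < real n" "0 < real k" "0 < real P" "0 < real n * t"
      using s n k_pos P_pos t by auto
    have ls: "ln (real s) \<le> ln (real n * t)" using \<open>real s \<le> real n * t\<close> pos by simp
    have e: "1 + ln (real n / x) + real k * (\<theta> + (1 - \<theta>) * ln (\<theta> * x * real k / real P))
        = (1 + ln (real n) + real k * (\<theta> + (1 - \<theta>) * (ln \<theta> + ln (real k) - ln (real P))))
          + (real k * (1 - \<theta>) - 1) * ln x" if "x > 0" for x
      using that pos \<theta> by (simp add: ln_div ln_mult algebra_simps)
    have "1 + ln (real n / real s) + real k * (\<theta> + (1 - \<theta>) * ln (\<theta> * real s * real k / real P))
        \<le> 1 + ln (real n / (real n * t)) + real k * (\<theta> + (1 - \<theta>) * ln (\<theta> * (real n * t) * real k / real P))"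
      unfolding e[OF pos(1)] e[OF pos(5)] using ls \<theta>(3) by (intro add_left_mono mult_left_mono) auto
    also have "ln (real n / (real n * t)) = - ln t" using pos t by (simp add: ln_div ln_mult)
    finally have le: "1 + ln (real n / real s) + real k * (\<theta> + (1 - \<theta>) * ln (\<theta> * real s * real k / real P)) \<le> g"
      using g by simp
    have "real (n choose s) * exp (real s * real k * (\<theta> + (1 - \<theta>) * ln (\<theta> * real s * real k / real P)))
       \<le> exp (real s * (1 + ln (real n / real s)))
          * exp (real s * real k * (\<theta> + (1 - \<theta>) * ln (\<theta> * real s * real k / real P)))"
      using sn s by (intro mult_right_mono binomial_le_exp) auto
    also have "\<dots> = exp (real s * (1 + ln (real n / real s) + real k * (\<theta> + (1 - \<theta>) * ln (\<theta> * real s * real k / real P))))"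
      by (simp add: algebra_simps flip: exp_add)
    also have "\<dots> \<le> exp (real s * g)" using le by (simp add: mult_left_mono)
    also have "\<dots> = exp g ^ s" by (simp add: exp_of_nat_mult)
    finally show "real (n choose s) *
           exp (real s * real k * (\<theta> + (1 - \<theta>) * ln (\<theta> * real s * real k / real P))) \<le> exp g ^ s" .
  qed
  also have "\<dots> \<le> 2 * exp g"
  proof (intro geometric_sum_le)
    have "exp g \<le> exp (- 1)" using g by simp
    also have "\<dots> \<le> (1 / 2 :: real)" using exp_ge_add_one_self[of 1] by (simp add: exp_minus field_simps)
    finally show "exp g \<le> 1 / 2" .
  qed simp
  finally show ?thesis .
qed

text \<open>
  A crude form of \<open>C(n, s) = exp(o(n))\<close> for \<open>s = o(n)\<close>, from \<open>ln y \<le> 2 sqrt y\<close>.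
\<close>
lemma choose_small_le_exp_sqrt:
  assumes "s \<ge> 1" "real s \<le> real n * t" "0 < t" "t \<le> 1"
  shows "real (n choose s) \<le> exp (3 * real n * sqrt t)"
proof -
  have "real n * t \<le> real n" using assms by (simp add: mult_left_le)
  then have sn: "s \<le> n" using assms by linarith
  have pos: "0 < real s" "0 < real n" using assms sn by auto
  have "ln (real n / real s) = 2 * ln (sqrt (real n / real s))" using pos by (simp add: ln_sqrt)
  also have "\<dots> \<le> 2 * sqrt (real n / real s)" using ln_bound[of "sqrt (real n / real s)"] pos by simp
  finally have "real s * (1 + ln (real n / real s)) \<le> real s * (1 + 2 * sqrt (real n / real s))"
    using pos by (intro mult_left_mono) auto
  also have "\<dots> = real s + 2 * (sqrt (real s) * sqrt (real n))"
    using pos by (simp add: real_sqrt_divide field_simps)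
  also have "\<dots> \<le> real n * sqrt t + 2 * (real n * sqrt t)"
  proof (intro add_mono mult_left_mono)
    have "t * 1 \<le> t * (1 / sqrt t)" using assms by (intro mult_left_mono) auto
    also have "\<dots> = sqrt t" using assms by (simp add: real_div_sqrt)
    finally have "real n * t \<le> real n * sqrt t" by (intro mult_left_mono) auto
    then show "real s \<le> real n * sqrt t" using assms by linarith
    have "sqrt (real s) * sqrt (real n) \<le> sqrt (real n * t) * sqrt (real n)"
      using assms by (intro mult_right_mono) auto
    also have "\<dots> = real n * sqrt t" by (simp add: real_sqrt_mult)
    finally show "sqrt (real s) * sqrt (real n) \<le> real n * sqrt t" .
  qed simp
  finally have "real s * (1 + ln (real n / real s)) \<le> 3 * real n * sqrt t" by simp
  then have le: "exp (real s * (1 + ln (real n / real s))) \<le> exp (3 * real n * sqrt t)" by simp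
  have "real (n choose s) \<le> exp (real s * (1 + ln (real n / real s)))"
    using sn assms(1) by (intro binomial_le_exp) auto
  then show ?thesis using le by (rule order.trans)
qed

text \<open>
  The summands are split according to whether the largest exponent in the Laplace transform is at
  most \<open>\<delta>\<close>. If so, the linear estimate gives a geometric series with ratio \<open>n powr (- \<epsilon>)\<close>; if not,
  the class \<open>r\<close> of the largest rings makes each of the at most \<open>n\<close> summands exponentially small.
\<close>
lemma separated_sum_le:
  assumes n: "n \<ge> 1" and \<theta>: "0 < \<theta>" and t: "0 < t" "t \<le> 1"
    and m: "real m \<le> real n * t"
    and r: "\<And>i. i \<in> set_pmf \<mu> \<Longrightarrow> K i \<le> K r" and \<delta>: "0 \<le> \<delta>" "\<delta> \<le> 2"
    and A: "A = real k * measure_pmf.expectation \<mu> (\<lambda>i. real (K i)) / real P"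
    and \<epsilon>: "(1 + \<epsilon>) * ln (real n) \<le> (1 - \<delta> / 2) * \<theta> * (1 - t) * (real n * A)" "1 \<le> \<epsilon> * ln (real n)"
    and c: "c = pmf \<mu> r * (1 - exp (- \<delta>))" "3 * sqrt t \<le> c / 4" "t \<le> 1 / 2"
  shows "(\<Sum>s\<in>{1..m}. real (n choose s) * laplace (\<theta> * real s * real k) ^ (n - s))
      \<le> 2 * exp (- \<epsilon> * ln (real n)) + real n * exp (- (real n * (c / 4)))"
proof -
  have A0: "0 \<le> A" unfolding A by (auto intro!: divide_nonneg_nonneg mult_nonneg_nonneg Bochner_Integration.integral_nonneg)
  have "real n * t \<le> real n" using t by (simp add: mult_left_le)
  then have mn: "m \<le> n" using m by linarith
  have c0: "0 \<le> c" unfolding c using \<delta> by auto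
  have "(\<Sum>s\<in>{1..m}. real (n choose s) * laplace (\<theta> * real s * real k) ^ (n - s))
      \<le> (\<Sum>s\<in>{1..m}. exp (- \<epsilon> * ln (real n)) ^ s + exp (- (real n * (c / 4))))"
  proof (intro sum_mono)
    fix s assume s: "s \<in> {1..m}"
    define a where "a = \<theta> * real s * real k"
    have a0: "0 \<le> a" using \<theta> by (simp add: a_def)
    have st: "real s \<le> real n * t" using s m by (auto intro: order.trans[OF _ m])
    have sn: "s \<le> n" using s mn by auto
    then have ns: "real n * (1 - t) \<le> real (n - s)" using st by (simp add: of_nat_diff algebra_simps)
    have pow: "real (n choose s) * laplace a ^ (n - s) \<le> real (n choose s) * exp (- (real n * ((1 - t) * b)))"
      if "laplace a \<le> exp (- b)" "0 \<le> b" for b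
    proof (intro mult_left_mono)
      have "laplace a ^ (n - s) \<le> exp (- b) ^ (n - s)" using that by (intro power_mono laplace_nonneg)
      also have "\<dots> = exp (- (real (n - s) * b))" by (simp add: exp_of_nat_mult [symmetric])
      also have "\<dots> \<le> exp (- (real n * ((1 - t) * b)))"
        using mult_right_mono[OF ns that(2)] by (simp add: mult_ac)
      finally show "laplace a ^ (n - s) \<le> exp (- (real n * ((1 - t) * b)))" .
    qed simp
    show "real (n choose s) * laplace (\<theta> * real s * real k) ^ (n - s)
        \<le> exp (- \<epsilon> * ln (real n)) ^ s + exp (- (real n * (c / 4)))"
    proof (cases "a * real (K r) / real P \<le> \<delta>")
      case True
      have "a * real (K i) / real P \<le> \<delta>" if "i \<in> set_pmf \<mu>" for i
      proof -
        have "a * real (K i) / real P \<le> a * real (K r) / real P"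
          using r[OF that] a0 by (intro divide_right_mono mult_left_mono) auto
        then show ?thesis using True by linarith
      qed
      from laplace_le_mean[OF a0 this]
      have "laplace a \<le> exp (- ((1 - \<delta> / 2) * (\<theta> * real s * A)))"
        unfolding A a_def by (simp add: mult_ac)
      from pow[OF this] \<delta> \<theta> A0
      have "real (n choose s) * laplace a ^ (n - s)
          \<le> real (n choose s) * exp (- (real n * ((1 - t) * ((1 - \<delta> / 2) * (\<theta> * real s * A)))))"
        by (auto intro!: mult_nonneg_nonneg)
      also have "\<dots> \<le> exp (real s * ln (real n)) * exp (- (real s * ((1 + \<epsilon>) * ln (real n))))"
      proof (intro mult_mono)
        have "real (n choose s) \<le> real n ^ s"
          using binomial_le_pow[OF sn] by (metis of_nat_le_iff of_nat_power)
        then show "real (n choose s) \<le> exp (real s * ln (real n))" using n by (simp add: exp_of_nat_mult)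
        have "real s * ((1 + \<epsilon>) * ln (real n)) \<le> real s * ((1 - \<delta> / 2) * \<theta> * (1 - t) * (real n * A))"
          using \<epsilon>(1) by (rule mult_left_mono) simp
        then show "exp (- (real n * ((1 - t) * ((1 - \<delta> / 2) * (\<theta> * real s * A))))) \<le> exp (- (real s * ((1 + \<epsilon>) * ln (real n))))"
          by (simp add: mult_ac)
      qed auto
      also have "\<dots> = exp (real s * (- \<epsilon> * ln (real n)))" by (simp add: algebra_simps flip: exp_add)
      also have "\<dots> = exp (- \<epsilon> * ln (real n)) ^ s" by (rule exp_of_nat_mult)
      finally show ?thesis unfolding a_def by (smt (verit) exp_gt_zero)
    next
      case False
      then have "\<delta> \<le> a * real (K r) / real P" by simp
      from pow[OF laplace_le_class[OF a0 this]] c0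
      have "real (n choose s) * laplace a ^ (n - s) \<le> real (n choose s) * exp (- (real n * ((1 - t) * c)))"
        unfolding c by simp
      also have "\<dots> \<le> exp (3 * real n * sqrt t) * exp (- (real n * ((1 - t) * c)))"
        using s st t by (intro mult_right_mono choose_small_le_exp_sqrt) auto
      also have "\<dots> \<le> exp (- (real n * (c / 4)))"
      proof -
        have "3 * sqrt t + c / 4 \<le> (1 - t) * c" using c(2) mult_right_mono[of "1 / 2" "1 - t" c] c(3) c0 by simp
        then have "real n * (3 * sqrt t + c / 4) \<le> real n * ((1 - t) * c)" by (rule mult_left_mono) simp
        then show ?thesis by (simp add: algebra_simps flip: exp_add)
      qed
      finally show ?thesis unfolding a_def by (smt (verit) exp_gt_zero zero_le_power)
    qed
  qed
  also have "\<dots> = (\<Sum>s\<in>{1..m}. exp (- \<epsilon> * ln (real n)) ^ s) + real m * exp (- (real n * (c / 4)))"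
    by (simp add: sum.distrib)
  also have "\<dots> \<le> 2 * exp (- \<epsilon> * ln (real n)) + real n * exp (- (real n * (c / 4)))"
  proof (intro add_mono geometric_sum_le mult_right_mono)
    have "exp (- \<epsilon> * ln (real n)) \<le> exp (- 1)" using \<epsilon> by simp
    also have "\<dots> \<le> (1 / 2 :: real)" using exp_ge_add_one_self[of 1] by (simp add: exp_minus field_simps)
    finally show "exp (- \<epsilon> * ln (real n)) \<le> 1 / 2" .
  qed (use mn in auto)
  finally show ?thesis .
qed

lemma large_cut_le:
  assumes n: "n \<ge> 2" and \<theta>: "0 < \<theta>" and m: "real n * t / 2 \<le> real m" and t: "0 \<le> t"
  shows "2 ^ n * laplace (\<theta> * real m * real k) ^ (n div 2)
      \<le> exp (real n * (1 - \<theta> * t * (real n * (real k)\<^sup>2 / real P) / 6))"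
proof -
  define b where "b = \<theta> * t * (real n * (real k)\<^sup>2 / real P) / 2"
  have b0: "0 \<le> b" using \<theta> t by (simp add: b_def)
  have a0: "0 \<le> \<theta> * real m * real k" using \<theta> by simp
  have "b = (\<theta> * (real n * t / 2) * real k) * real k / real P" by (simp add: b_def power2_eq_square mult_ac)
  also have "\<dots> \<le> (\<theta> * real m * real k) * real k / real P"
    using m \<theta> by (intro divide_right_mono mult_right_mono mult_left_mono) auto
  finally have "laplace (\<theta> * real m * real k) \<le> exp (- b)"
    using laplace_le_min[OF a0] by (smt (verit) exp_le_cancel_iff)
  then have "laplace (\<theta> * real m * real k) ^ (n div 2) \<le> exp (- b) ^ (n div 2)"
    by (intro power_mono laplace_nonneg)
  also have "\<dots> = exp (- (real (n div 2) * b))" by (simp add: exp_of_nat_mult [symmetric])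
  also have "\<dots> \<le> exp (- (real n / 3 * b))"
  proof -
    have "n \<le> 3 * (n div 2)" using n by presburger
    then have "real n \<le> 3 * real (n div 2)" by linarith
    then have "real n / 3 * b \<le> real (n div 2) * b" by (intro mult_right_mono b0) simp
    then show ?thesis by simp
  qed
  finally have 1: "laplace (\<theta> * real m * real k) ^ (n div 2) \<le> exp (- (real n / 3 * b))" .
  have "(2::real) ^ n \<le> exp 1 ^ n" using exp_ge_add_one_self[of 1] by (intro power_mono) auto
  then have "(2::real) ^ n \<le> exp (real n)" by (simp add: exp_of_nat_mult [symmetric])
  with 1 have "2 ^ n * laplace (\<theta> * real m * real k) ^ (n div 2) \<le> exp (real n) * exp (- (real n / 3 * b))"
    by (intro mult_mono) (auto simp: laplace_nonneg)
  also have "\<dots> = exp (real n * (1 - \<theta> * t * (real n * (real k)\<^sup>2 / real P) / 6))"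
    by (simp add: b_def algebra_simps flip: exp_add)
  finally show ?thesis .
qed

text \<open>
  The first moment bound: a singleton always has a ring union of at least \<open>k\<close> keys.
\<close>
lemma prob_isolated_le:
  fixes V :: "'v set"
  assumes V: "finite V" "card V = n"
    and A: "A = real k * measure_pmf.expectation \<mu> (\<lambda>i. real (K i)) / real P"
    and \<delta>: "\<And>i. i \<in> set_pmf \<mu> \<Longrightarrow> real k * real (K i) / real P \<le> \<delta>"
  shows "measure_pmf.prob (Pi_pmf V {} (\<lambda>_. D)) {\<Sigma>. \<exists>x\<in>V. separated V \<Sigma> {x}}
      \<le> real n * exp (- (real (n - 1) * ((1 - \<delta> / 2) * A)))"
proof -
  let ?M = "Pi_pmf V {} (\<lambda>_. D)"
  let ?E = "\<lambda>S. {\<Sigma>. real k \<le> real (card (\<Union>x\<in>S. \<Sigma> x)) \<and> separated V \<Sigma> S}"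
  have "measure_pmf.prob ?M {\<Sigma>. \<exists>x\<in>V. separated V \<Sigma> {x}}
      \<le> measure_pmf.prob ?M (\<Union>S\<in>{S. S \<subseteq> V \<and> card S \<in> {1}}. ?E S)"
  proof (intro measure_pmf.finite_measure_mono_AE, unfold AE_measure_pmf_iff, intro ballI impI)
    fix \<Sigma> assume \<Sigma>: "\<Sigma> \<in> set_pmf ?M" "\<Sigma> \<in> {\<Sigma>. \<exists>x\<in>V. separated V \<Sigma> {x}}"
    then obtain x where x: "x \<in> V" "separated V \<Sigma> {x}" by blast
    have "\<Sigma> x \<in> set_pmf D"
      using subsetD[OF set_Pi_pmf_subset'[OF V(1)] \<Sigma>(1)] x(1) by (simp add: PiE_dflt_def)
    then have "k \<le> card (\<Sigma> x)" using D_ring by blast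
    then have "\<Sigma> \<in> ?E {x}" using x(2) by simp
    moreover have "{x} \<in> {S. S \<subseteq> V \<and> card S \<in> {1}}" using x(1) by simp
    ultimately show "\<Sigma> \<in> (\<Union>S\<in>{S. S \<subseteq> V \<and> card S \<in> {1}}. ?E S)" by (rule UN_I[rotated])
  qed simp
  also have "\<dots> \<le> (\<Sum>s\<in>{1}. real (card V choose s) * laplace (real k) ^ (n - s))"
  proof (intro sum_over_subsets_le V)
    fix s S assume "s \<in> {1::nat}" "S \<subseteq> V" "card S = s"
    then show "measure_pmf.prob ?M (?E S) \<le> laplace (real k) ^ (n - s)"
      using prob_separated_large_union_le[OF V(1), of S "real k"] V(2) by simp
  qed simp
  also have "\<dots> = real n * laplace (real k) ^ (n - 1)" using V by simp
  also have "\<dots> \<le> real n * exp (- ((1 - \<delta> / 2) * A)) ^ (n - 1)"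
    using laplace_le_mean[of "real k" \<delta>] \<delta> unfolding A
    by (intro mult_left_mono power_mono laplace_nonneg) auto
  finally show ?thesis by (simp add: exp_of_nat_mult [symmetric])
qed

text \<open>
  The form of \<open>prob_cut_le\<close> that is ready for a passage to the limit, with \<open>m = \<lfloor>n t\<rfloor>\<close>. The
  hypothesis \<open>2 \<le> n t\<close> keeps \<open>m\<close> above \<open>n t / 2\<close> after rounding.
\<close>
lemma prob_cut_le_explicit:
  fixes V :: "'v set"
  assumes V: "finite V" "card V = n" "n \<ge> 2"
    and \<theta>: "0 < \<theta>" "\<theta> < 1" "1 \<le> real k * (1 - \<theta>)"
    and t: "0 < t" "t \<le> 1 / 2" "2 \<le> real n * t"
    and P: "\<theta> * (real n * t) * real k / real P \<le> 1"
    and g: "1 - ln t + real k * (\<theta> + (1 - \<theta>) * ln (\<theta> * (real n * t) * real k / real P)) \<le> g" "g \<le> - 1"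
    and r: "\<And>i. i \<in> set_pmf \<mu> \<Longrightarrow> K i \<le> K r" and \<delta>: "0 \<le> \<delta>" "\<delta> \<le> 2"
    and A: "A = real k * measure_pmf.expectation \<mu> (\<lambda>i. real (K i)) / real P"
    and \<epsilon>: "(1 + \<epsilon>) * ln (real n) \<le> (1 - \<delta> / 2) * \<theta> * (1 - t) * (real n * A)" "1 \<le> \<epsilon> * ln (real n)"
    and c: "c = pmf \<mu> r * (1 - exp (- \<delta>))" "3 * sqrt t \<le> c / 4"
  shows "measure_pmf.prob (Pi_pmf V {} (\<lambda>_. D)) {\<Sigma>. \<exists>S\<subseteq>V. S \<noteq> {} \<and> 2 * card S \<le> n \<and> separated V \<Sigma> S}
    \<le> 2 * exp g + (2 * exp (- \<epsilon> * ln (real n)) + real n * exp (- (real n * (c / 4))))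
      + exp (real n * (1 - \<theta> * t * (real n * (real k)\<^sup>2 / real P) / 6))"
proof -
  define m where "m = nat \<lfloor>real n * t\<rfloor>"
  have m: "real m \<le> real n * t" "real n * t - 1 \<le> real m" using t unfolding m_def by linarith+
  then have m2: "real n * t / 2 \<le> real m" "m \<ge> 1" using t by linarith+
  have "\<theta> * real m * real k \<le> \<theta> * (real n * t) * real k"
    using m \<theta> by (intro mult_right_mono mult_left_mono) auto
  also have "\<dots> \<le> real P" using P P_pos by (simp add: divide_le_eq)
  finally have b: "\<theta> * real m * real k \<le> real P" .
  have t1: "t \<le> 1" "0 \<le> t" "n \<ge> 1" using t V by auto
  have "(\<Sum>s\<in>{1..m}. real (n choose s) *
           exp (real s * real k * (\<theta> + (1 - \<theta>) * ln (\<theta> * real s * real k / real P)))) \<le> 2 * exp g"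
    by (rule small_union_sum_le[OF t1(3) \<theta> t(1) t1(1) m(1) g])
  moreover have "(\<Sum>s\<in>{1..m}. real (n choose s) * laplace (\<theta> * real s * real k) ^ (n - s))
      \<le> 2 * exp (- \<epsilon> * ln (real n)) + real n * exp (- (real n * (c / 4)))"
    by (rule separated_sum_le[OF t1(3) \<theta>(1) t(1) t1(1) m(1) r \<delta> A \<epsilon> c t(2)])
  moreover have "2 ^ n * laplace (\<theta> * real m * real k) ^ (n div 2)
      \<le> exp (real n * (1 - \<theta> * t * (real n * (real k)\<^sup>2 / real P) / 6))"
    by (rule large_cut_le[OF V(3) \<theta>(1) m2(1) t1(2)])
  ultimately show ?thesis using prob_cut_le[OF V(1,2) \<theta>(1,2) m2(2) b] by linarith
qed

end

section \<open>Isolation and connectivity of the key graph\<close>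

lemma arcs_ends_key_graph:
  "arcs_ends (with_proj (key_graph n \<Sigma>))
     = {(x, y). x \<in> {1..n} \<and> y \<in> {1..n} \<and> x \<noteq> y \<and> \<Sigma> x \<inter> \<Sigma> y \<noteq> {}}"
  by (simp add: key_graph_def)

lemma isolated_node_key_graph_iff:
  "isolated_node (with_proj (key_graph n \<Sigma>)) v \<longleftrightarrow> v \<in> {1..n} \<and> separated {1..n} \<Sigma> {v}"
  unfolding isolated_node_def arcs_ends_key_graph separated_def
  by (auto simp: key_graph_def Int_commute)

lemma separated_Diff:
  assumes "S \<subseteq> V" "separated V \<Sigma> S" shows "separated V \<Sigma> (V - S)"
  using assms unfolding separated_def by (auto simp: Int_commute)

text \<open>
  If no nontrivial set is separated, the set of nodes reachable from a given one is separated and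
  must be everything. Conversely, a path cannot leave a separated set.
\<close>
lemma connected_key_graph_iff:
  "Digraph_Component.connected (with_proj (key_graph n \<Sigma>)) \<longleftrightarrow>
     n \<ge> 1 \<and> (\<forall>S\<subseteq>{1..n}. S \<noteq> {} \<longrightarrow> S \<noteq> {1..n} \<longrightarrow> \<not> separated {1..n} \<Sigma> S)"
proof -
  interpret pair_graph "key_graph n \<Sigma>" by (rule pair_graph_key_graph)
  let ?V = "{1..n}" and ?E = "(arcs_ends (with_proj (key_graph n \<Sigma>)))\<^sup>s"
  have E: "(x, y) \<in> ?E \<longleftrightarrow> x \<in> ?V \<and> y \<in> ?V \<and> x \<noteq> y \<and> \<Sigma> x \<inter> \<Sigma> y \<noteq> {}" for x y
    unfolding symcl_def arcs_ends_key_graph by (auto simp: Int_commute)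
  have conn: "Digraph_Component.connected (with_proj (key_graph n \<Sigma>)) \<longleftrightarrow>
      n \<ge> 1 \<and> (\<forall>u\<in>?V. \<forall>v\<in>?V. (u, v) \<in> rtrancl_on ?V ?E)"
    unfolding connected_conv by (auto simp: key_graph_def)
  show ?thesis unfolding conn
  proof (intro conj_cong refl iffI allI impI ballI)
    fix S assume *: "\<forall>u\<in>?V. \<forall>v\<in>?V. (u, v) \<in> rtrancl_on ?V ?E" "S \<subseteq> ?V" "S \<noteq> {}" "S \<noteq> ?V"
    then obtain u v where uv: "u \<in> S" "v \<in> ?V - S" by blast
    show "\<not> separated ?V \<Sigma> S"
    proof
      assume sep: "separated ?V \<Sigma> S"
      have "(u, v) \<in> rtrancl_on ?V ?E" using uv * by blast
      then have "v \<in> S"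
      proof (induction rule: rtrancl_on_induct)
        case (step y z)
        then show ?case using sep unfolding E separated_def by blast
      qed (use uv in auto)
      with uv show False by simp
    qed
  next
    fix u v assume *: "\<forall>S\<subseteq>?V. S \<noteq> {} \<longrightarrow> S \<noteq> ?V \<longrightarrow> \<not> separated ?V \<Sigma> S" "u \<in> ?V" "v \<in> ?V"
    define S where "S = {y \<in> ?V. (u, y) \<in> rtrancl_on ?V ?E}"
    have "separated ?V \<Sigma> S"
      unfolding separated_def
    proof (intro ballI, rule ccontr)
      fix x y assume "x \<in> S" "y \<in> ?V - S" "\<Sigma> x \<inter> \<Sigma> y \<noteq> {}"
      then have "(x, y) \<in> ?E" "(u, x) \<in> rtrancl_on ?V ?E" "y \<in> ?V" unfolding E S_def by auto
      then have "(u, y) \<in> rtrancl_on ?V ?E" by (metis rtrancl_on_into_rtrancl_on)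
      then have "y \<in> S" using \<open>y \<in> ?V\<close> unfolding S_def by simp
      then show False using \<open>y \<in> ?V - S\<close> by simp
    qed
    moreover have "u \<in> S" "S \<subseteq> ?V" using * unfolding S_def by auto
    ultimately have "S = ?V" using * by blast
    then show "(u, v) \<in> rtrancl_on ?V ?E" using * unfolding S_def by blast
  qed
qed

lemma connected_key_graph_imp_no_isolated:
  assumes "n \<ge> 2" "Digraph_Component.connected (with_proj (key_graph n \<Sigma>))"
  shows "\<not> isolated_node (with_proj (key_graph n \<Sigma>)) v"
proof
  assume "isolated_node (with_proj (key_graph n \<Sigma>)) v"
  then have v: "{v} \<subseteq> {1..n}" "separated {1..n} \<Sigma> {v}" by (auto simp: isolated_node_key_graph_iff)
  have "{v} \<noteq> {1..n}" using assms(1) 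
    by (metis card_atLeastAtMost card_1_singleton_iff diff_Suc_1 not_numeral_le_zero numeral_2_eq_2 One_nat_def Suc_n_not_le_n)
  with v show False using assms(2) unfolding connected_key_graph_iff by blast
qed

text \<open>
  Separation passes to complements, so one may take the smaller side.
\<close>
lemma disconnected_key_graph_imp_cut:
  assumes "n \<ge> 1" "\<not> Digraph_Component.connected (with_proj (key_graph n \<Sigma>))"
  shows "\<exists>S\<subseteq>{1..n}. S \<noteq> {} \<and> 2 * card S \<le> n \<and> separated {1..n} \<Sigma> S"
proof -
  obtain S where S: "S \<subseteq> {1..n}" "S \<noteq> {}" "S \<noteq> {1..n}" "separated {1..n} \<Sigma> S"
    using assms unfolding connected_key_graph_iff by blast
  have "card S + card ({1..n} - S) = n" 
    using S card_mono[OF _ S(1)] by (simp add: card_Diff_subset finite_subset[OF S(1)])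
  then consider "2 * card S \<le> n" | "2 * card ({1..n} - S) \<le> n" by linarith
  then show ?thesis
  proof cases
    case 2
    then show ?thesis using S separated_Diff[OF S(1,4)] by (intro exI[of _ "{1..n} - S"]) auto
  qed (use S in blast)
qed

section \<open>Limits along a scaling\<close>

lemma scaling_sandwich:
  assumes "scaling r K P" "n \<ge> 2" "i \<in> {1..r}"
  shows "1 \<le> K n 1" "K n 1 \<le> K n i" "K n i \<le> K n r" "K n i \<le> P n"
proof -
  have mono: "a \<le> b \<Longrightarrow> 1 \<le> a \<Longrightarrow> b \<le> r \<Longrightarrow> K n a \<le> K n b" for a b
  proof (induction b rule: dec_induct)
    case (step b)
    then show ?case using assms(1,2) unfolding scaling_def by (force intro: order.trans)
  qed simp
  show "1 \<le> K n 1" using assms unfolding scaling_def by blast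
  show "K n 1 \<le> K n i" "K n i \<le> K n r" using mono assms(3) by auto
  then show "K n i \<le> P n" using assms(1,2) unfolding scaling_def by (meson le_trans less_imp_le)
qed

locale critical_scaling =
  fixes r :: nat and \<mu> :: "nat pmf"
    and K :: "nat \<Rightarrow> nat \<Rightarrow> nat" and P :: "nat \<Rightarrow> nat" and c :: real
  assumes r: "r \<ge> 1"
    and classes: "set_pmf \<mu> = {1..r}"
    and scal: "scaling r K P"
    and c_pos: "c > 0"
    and critical: "(\<lambda>n. real (K n 1) * measure_pmf.expectation \<mu> (\<lambda>i. real (K n i)) / real (P n))
           \<sim>[at_top] (\<lambda>n. c * (ln (real n) / real n))"
begin

text \<open>
  By \<open>critical\<close>, the load is asymptotic to \<open>c ln n / n\<close>; the ratio below is introduced because it simply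
  converges to \<open>c\<close>.
\<close>
definition load :: "nat \<Rightarrow> real" where
  "load n = real (K n 1) * measure_pmf.expectation \<mu> (\<lambda>i. real (K n i)) / real (P n)"

definition load_ratio :: "nat \<Rightarrow> real" where
  "load_ratio n = real n * load n / ln (real n)"

lemma law: "n \<ge> 2 \<Longrightarrow> key_ring_law \<mu> (K n) (P n) (K n 1)"
  using scaling_sandwich[OF scal, of n] r classes by unfold_locales (auto simp: Suc_le_eq)

lemma class_pos: "pmf \<mu> 1 > 0" "pmf \<mu> r > 0" using classes r by (auto intro: pmf_positive)

lemma class_le: "n \<ge> 2 \<Longrightarrow> i \<in> set_pmf \<mu> \<Longrightarrow> K n i \<le> K n r"
  using scaling_sandwich[OF scal] classes by auto

lemma integrable_classes: "integrable (measure_pmf \<mu>) (f :: nat \<Rightarrow> real)"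
  by (intro integrable_measure_pmf_finite) (simp add: classes)

text \<open>
  All classes have a fixed positive probability, so the largest ring size is at most a constant
  multiple of the mean ring size.
\<close>
lemma class_load_le:
  assumes "n \<ge> 2" "i \<in> set_pmf \<mu>"
  shows "real (K n 1) * real (K n i) / real (P n) \<le> load n / pmf \<mu> r"
proof -
  have "pmf \<mu> r * real (K n i) \<le> pmf \<mu> r * real (K n r)"
    using class_le[OF assms] by (intro mult_left_mono) auto
  also have "\<dots> = measure_pmf.expectation \<mu> (\<lambda>j. real (K n r) * indicator {r} j)" 
    by (simp add: measure_pmf_single)
  also have "\<dots> \<le> measure_pmf.expectation \<mu> (\<lambda>j. real (K n j))"
    by (intro integral_mono integrable_classes) (auto simp: indicator_def)
  finally have "real (K n 1) * (pmf \<mu> r * real (K n i)) / real (P n) \<le> load n"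
    unfolding load_def by (intro divide_right_mono mult_left_mono) auto
  then show ?thesis using class_pos by (simp add: field_simps)
qed

lemma load_ratio_tendsto: "load_ratio \<longlonglongrightarrow> c"
proof -
  have ev: "eventually (\<lambda>n. c * (ln (real n) / real n) \<noteq> 0) at_top"
    using eventually_ge_at_top[of 2] by eventually_elim (use c_pos in auto)
  have "(\<lambda>n. load n / (c * (ln (real n) / real n))) \<longlonglongrightarrow> 1"
    unfolding load_def by (rule asymp_equivD_strong[OF critical]) (use ev in \<open>auto elim: eventually_mono\<close>)
  then have "(\<lambda>n. c * (load n / (c * (ln (real n) / real n)))) \<longlonglongrightarrow> c * 1" by (intro tendsto_intros)
  then have "(\<lambda>n. c * (load n / (c * (ln (real n) / real n)))) \<longlonglongrightarrow> c" by simp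
  then show ?thesis
    by (rule Lim_transform_eventually)
       (use eventually_ge_at_top[of 2] in eventually_elim, use c_pos in \<open>auto simp: load_ratio_def field_simps\<close>)
qed

lemma load_eq_ratio: "n \<ge> 2 \<Longrightarrow> real n * load n = load_ratio n * ln (real n)"
  by (simp add: load_ratio_def)

lemma load_tendsto: "load \<longlonglongrightarrow> 0"
proof -
  have "(\<lambda>n. ln (real n) / real n) \<longlonglongrightarrow> 0" by real_asymp
  then have "(\<lambda>n. load_ratio n * (ln (real n) / real n)) \<longlonglongrightarrow> c * 0" by (intro tendsto_intros load_ratio_tendsto)
  then have "(\<lambda>n. load_ratio n * (ln (real n) / real n)) \<longlonglongrightarrow> 0" by simp
  then show ?thesis
    by (rule Lim_transform_eventually)
       (use eventually_ge_at_top[of 2] in eventually_elim, auto simp: load_ratio_def)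
qed

lemma load_sq_tendsto: "(\<lambda>n. real n * (load n)\<^sup>2) \<longlonglongrightarrow> 0"
proof -
  have "(\<lambda>n. (ln (real n))\<^sup>2 / real n) \<longlonglongrightarrow> 0" by real_asymp
  then have "(\<lambda>n. (load_ratio n)\<^sup>2 * ((ln (real n))\<^sup>2 / real n)) \<longlonglongrightarrow> c\<^sup>2 * 0" by (intro tendsto_intros load_ratio_tendsto)
  then have "(\<lambda>n. (load_ratio n)\<^sup>2 * ((ln (real n))\<^sup>2 / real n)) \<longlonglongrightarrow> 0" by simp
  then show ?thesis
    by (rule Lim_transform_eventually)
       (use eventually_ge_at_top[of 2] in eventually_elim, auto simp: load_ratio_def power2_eq_square)
qed

definition prob_no_isolated :: "nat \<Rightarrow> real" where
  "prob_no_isolated n = measure_pmf.prob (inhom_random_key_graph n \<mu> (K n) (P n))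
                {G. \<not> (\<exists>v. isolated_node (with_proj G) v)}"

definition prob_connected :: "nat \<Rightarrow> real" where
  "prob_connected n = measure_pmf.prob (inhom_random_key_graph n \<mu> (K n) (P n))
                {G. Digraph_Component.connected (with_proj G)}"

abbreviation rings :: "nat \<Rightarrow> (nat \<Rightarrow> nat set) pmf" where
  "rings n \<equiv> Pi_pmf {1..n} {} (\<lambda>_. key_ring_pmf \<mu> (K n) (P n))"

lemma prob_no_isolated_eq:
  "prob_no_isolated n = measure_pmf.prob (rings n) {\<Sigma>. \<forall>x\<in>{1..n}. \<not> separated {1..n} \<Sigma> {x}}"
  unfolding prob_no_isolated_def inhom_random_key_graph_def measure_map_pmf
  by (intro arg_cong[where f = "measure_pmf.prob (rings n)"]) (auto simp: isolated_node_key_graph_iff)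

text \<open>
  In the bound from the second moment method, the inverse of the mean number of counted nodes contributes
  \<open>exp(n load - ln n)\<close>, which is \<open>n powr (c - 1 + o(1))\<close>; all error terms are of order
  \<open>load + n load\<^sup>2\<close>.
\<close>
lemma prob_no_isolated_tendsto_0:
  assumes "c < 1" shows "prob_no_isolated \<longlonglongrightarrow> 0"
proof (rule tendsto_sandwich[OF _ _ tendsto_const])
  let ?ub = "\<lambda>n. exp (- ((1 - load_ratio n) * ln (real n) - 2 * (real n * (load n)\<^sup>2))) / pmf \<mu> 1
      + (exp (4 / (pmf \<mu> r)\<^sup>2 * (real n * (load n)\<^sup>2) + 2 * (load n + 2 * (load n)\<^sup>2)) - 1)"
  show "eventually (\<lambda>n. prob_no_isolated n \<le> ?ub n) sequentially"
    using eventually_ge_at_top[of 2] order_tendstoD(2)[OF load_tendsto, of "1 / 2", simplified]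
  proof eventually_elim
    case (elim n)
    interpret key_ring_law \<mu> "K n" "P n" "K n 1" by (rule law) fact
    have "prob_no_isolated n \<le> exp (real n * (load n + 2 * (load n)\<^sup>2)) / (real n * pmf \<mu> 1)
        + exp (4 * real n * (load n / pmf \<mu> r)\<^sup>2 + 2 * (load n + 2 * (load n)\<^sup>2)) - 1"
      unfolding prob_no_isolated_eq
      using elim r class_load_le classes
      by (intro prob_no_isolated_le[where j = 1]) (auto simp: load_def)
    also have "exp (real n * (load n + 2 * (load n)\<^sup>2)) / (real n * pmf \<mu> 1)
        = exp (- ((1 - load_ratio n) * ln (real n) - 2 * (real n * (load n)\<^sup>2))) / pmf \<mu> 1"
    proof -
      have "- ((1 - load_ratio n) * ln (real n) - 2 * (real n * (load n)\<^sup>2)) = real n * (load n + 2 * (load n)\<^sup>2) - ln (real n)"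
        using load_eq_ratio[of n] elim by (simp add: algebra_simps)
      then show ?thesis using elim by (simp add: exp_diff)
    qed
    finally show ?case by (simp add: power_divide mult.assoc)
  qed
  have "filterlim (\<lambda>n. (1 - load_ratio n) * ln (real n)) at_top sequentially"
  proof (rule filterlim_tendsto_pos_mult_at_top)
    show "(\<lambda>n. 1 - load_ratio n) \<longlonglongrightarrow> 1 - c" by (intro tendsto_intros load_ratio_tendsto)
    show "filterlim (\<lambda>n. ln (real n)) at_top sequentially" by real_asymp
  qed (use assms in simp)
  then have "filterlim (\<lambda>n. - (2 * (real n * (load n)\<^sup>2)) + (1 - load_ratio n) * ln (real n)) at_top sequentially"
    by (rule filterlim_tendsto_add_at_top[OF tendsto_minus[OF tendsto_mult[OF tendsto_const load_sq_tendsto]]])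
  then have "filterlim (\<lambda>n. (1 - load_ratio n) * ln (real n) - 2 * (real n * (load n)\<^sup>2)) at_top sequentially"
    by (simp add: add.commute)
  then have "(\<lambda>n. exp (- ((1 - load_ratio n) * ln (real n) - 2 * (real n * (load n)\<^sup>2)))) \<longlonglongrightarrow> 0"
    by (intro filterlim_compose[OF exp_at_bot]) (simp add: filterlim_uminus_at_bot)
  then have "?ub \<longlonglongrightarrow> 0 / pmf \<mu> 1 + (exp (4 / (pmf \<mu> r)\<^sup>2 * 0 + 2 * (0 + 2 * 0\<^sup>2)) - 1)"
    using class_pos by (intro tendsto_intros load_tendsto load_sq_tendsto) auto
  then show "?ub \<longlonglongrightarrow> 0" by simp
qed (simp add: prob_no_isolated_def)

lemma prob_no_isolated_tendsto_1:
  assumes "c > 1" shows "prob_no_isolated \<longlonglongrightarrow> 1"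
proof (rule tendsto_sandwich[OF _ _ _ tendsto_const])
  let ?Y = "\<lambda>n. (real n - 1) / real n * (1 - load n / pmf \<mu> r / 2) * load_ratio n"
  let ?lb = "\<lambda>n. 1 - exp (- ((?Y n - 1) * ln (real n)))"
  show "eventually (\<lambda>n. ?lb n \<le> prob_no_isolated n) sequentially"
    using eventually_ge_at_top[of 2]
  proof eventually_elim
    case (elim n)
    interpret key_ring_law \<mu> "K n" "P n" "K n 1" by (rule law) fact
    have "1 - prob_no_isolated n = measure_pmf.prob (rings n) (UNIV - {\<Sigma>. \<forall>x\<in>{1..n}. \<not> separated {1..n} \<Sigma> {x}})"
      unfolding prob_no_isolated_eq by (subst measure_pmf.prob_compl[symmetric]) auto
    also have "UNIV - {\<Sigma>. \<forall>x\<in>{1..n}. \<not> separated {1..n} \<Sigma> {x}} = {\<Sigma>. \<exists>x\<in>{1..n}. separated {1..n} (\<Sigma> :: nat \<Rightarrow> nat set) {x}}"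
      by auto
    also have "measure_pmf.prob (rings n) \<dots> \<le> real n * exp (- (real (n - 1) * ((1 - load n / pmf \<mu> r / 2) * load n)))"
      using elim class_load_le by (intro prob_isolated_le) (auto simp: load_def)
    also have "\<dots> = exp (- ((?Y n - 1) * ln (real n)))"
    proof -
      have "?Y n * ln (real n) = (real n - 1) / real n * (1 - load n / pmf \<mu> r / 2) * (real n * load n)"
        using load_eq_ratio[OF elim] by simp
      also have "\<dots> = real (n - 1) * ((1 - load n / pmf \<mu> r / 2) * load n)"
        using elim by (simp add: of_nat_diff)
      finally have "- ((?Y n - 1) * ln (real n)) = ln (real n) + - (real (n - 1) * ((1 - load n / pmf \<mu> r / 2) * load n))"
        by (simp add: left_diff_distrib)
      then show ?thesis using elim by (simp only: exp_add) simp
    qed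
    finally show ?case by simp
  qed
  have "(\<lambda>n. (real n - 1) / real n) \<longlonglongrightarrow> 1" by real_asymp
  then have "(\<lambda>n. ?Y n - 1) \<longlonglongrightarrow> 1 * (1 - 0 / pmf \<mu> r / 2) * c - 1"
    using class_pos by (intro tendsto_intros load_tendsto load_ratio_tendsto) auto
  then have Y: "(\<lambda>n. ?Y n - 1) \<longlonglongrightarrow> c - 1" by simp
  have "filterlim (\<lambda>n. (?Y n - 1) * ln (real n)) at_top sequentially"
    by (rule filterlim_tendsto_pos_mult_at_top[OF Y]) (use assms in simp, real_asymp)
  then have "(\<lambda>n. exp (- ((?Y n - 1) * ln (real n)))) \<longlonglongrightarrow> 0"
    by (intro filterlim_compose[OF exp_at_bot]) (simp add: filterlim_uminus_at_bot)
  then have "?lb \<longlonglongrightarrow> 1 - 0" by (intro tendsto_intros)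
  then show "?lb \<longlonglongrightarrow> 1" by simp
qed (simp add: prob_no_isolated_def)

lemma prob_connected_tendsto_0:
  assumes "c < 1" shows "prob_connected \<longlonglongrightarrow> 0"
proof (rule tendsto_sandwich[OF _ _ tendsto_const prob_no_isolated_tendsto_0[OF assms]])
  show "eventually (\<lambda>n. prob_connected n \<le> prob_no_isolated n) sequentially"
    using eventually_ge_at_top[of 2]
  proof eventually_elim
    case (elim n)
    then show ?case
      unfolding prob_connected_def prob_no_isolated_def inhom_random_key_graph_def measure_map_pmf
      by (intro measure_pmf.finite_measure_mono) (auto dest: connected_key_graph_imp_no_isolated)
  qed
qed (simp add: prob_connected_def)

lemma prob_connected_ge:
  assumes "n \<ge> 1"
  shows "1 - measure_pmf.prob (rings n) {\<Sigma>. \<exists>S\<subseteq>{1..n}. S \<noteq> {} \<and> 2 * card S \<le> n \<and> separated {1..n} \<Sigma> S} \<le> prob_connected n"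
proof -
  let ?C = "{\<Sigma>. \<exists>S\<subseteq>{1..n}. S \<noteq> {} \<and> 2 * card S \<le> n \<and> separated {1..n} (\<Sigma> :: nat \<Rightarrow> nat set) S}"
  have "1 - measure_pmf.prob (rings n) ?C = measure_pmf.prob (rings n) (UNIV - ?C)"
    by (subst measure_pmf.prob_compl[symmetric]) auto
  also have "\<dots> \<le> prob_connected n"
    unfolding prob_connected_def inhom_random_key_graph_def measure_map_pmf
    using disconnected_key_graph_imp_cut[OF assms] by (intro measure_pmf.finite_measure_mono) auto
  finally show ?thesis .
qed

text \<open>
  The choice of \<open>\<theta>\<close> gives \<open>\<theta>\<^sup>2 > 1 / c\<close>: one factor \<open>\<theta>\<close> is lost to overlaps of the rings and the other one,
  \<open>1 - \<delta> / 2 = \<theta>\<close>, to the linear estimate of the Laplace transform. With \<open>P n \<ge> \<sigma> n\<close>, the function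
  \<open>g\<close> of \<open>k = K\<^sub>1\<close> bounds the exponent in \<open>small_union_sum_le\<close> after \<open>w \<le> k\<^sup>2 / \<sigma>\<close> has been inserted; it
  tends to \<open>- \<infinity>\<close> because the logarithm with the factor \<open>k\<close> has an argument tending to \<open>0\<close>.
\<close>
lemma prob_connected_tendsto_1:
  assumes c: "c > 1"
    and P_lin: "(\<lambda>n. real (P n)) \<in> \<Omega>(\<lambda>n. real n)"
    and K_sq: "(\<lambda>n. (real (K n 1))\<^sup>2 / real (P n)) \<in> \<omega>(\<lambda>n. 1 / real n)"
  shows "prob_connected \<longlonglongrightarrow> 1"
proof -
  obtain \<sigma> where \<sigma>: "\<sigma> > 0" "eventually (\<lambda>n. real (P n) \<ge> \<sigma> * real n) sequentially"
    using landau_omega.bigE[OF P_lin] by (auto simp: mult.commute)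
  define \<theta> where "\<theta> = 1 - (1 - 1 / c) / 3"
  define \<delta> where "\<delta> = 2 * (1 - \<theta>)"
  define \<rho> where "\<rho> = pmf \<mu> r * (1 - exp (- \<delta>))"
  define \<epsilon> where "\<epsilon> = (\<theta>\<^sup>2 * c - 1) / 2"
  define k where "k n = real (K n 1)" for n
  define w where "w n = real n * (k n)\<^sup>2 / real (P n)" for n
  define t where "t n = w n powr (- 3 / 4)" for n
  define g where "g x = 1 + 3 / 4 * ln (x\<^sup>2 / \<sigma>) + x * (\<theta> + (1 - \<theta>) * ln (\<theta> * ((x\<^sup>2 / \<sigma>) powr (1 / 4) / x)))" for x :: real
  have \<theta>: "0 < \<theta>" "\<theta> < 1" using c by (auto simp: \<theta>_def field_simps)
  have \<delta>: "0 < \<delta>" "\<delta> \<le> 2" using \<theta> by (auto simp: \<delta>_def)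
  have \<rho>: "\<rho> > 0" using \<delta> class_pos by (simp add: \<rho>_def)
  have \<epsilon>: "\<epsilon> > 0"
  proof -
    have "1 / c < 1 - 2 / 3 * (1 - 1 / c)" using c by (simp add: field_simps)
    also have "\<dots> \<le> 1 - 2 / 3 * (1 - 1 / c) + ((1 - 1 / c) / 3)\<^sup>2" by simp
    also have "\<dots> = \<theta>\<^sup>2" unfolding \<theta>_def power2_diff by simp
    finally have "1 < \<theta>\<^sup>2 * c" using c by (simp add: field_simps)
    then show ?thesis by (simp add: \<epsilon>_def)
  qed
  have w_top: "filterlim w at_top sequentially"
  proof -
    have "eventually (\<lambda>n. 1 / real n \<noteq> 0) sequentially" 
      using eventually_gt_at_top[of 0] by eventually_elim auto
    from smallomegaD_filterlim_at_top_norm[OF K_sq this] show ?thesis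
      by (simp add: w_def[abs_def] k_def mult.commute)
  qed
  have w_ge: "eventually (\<lambda>n. w n \<ge> b) sequentially" for b
    using w_top by (simp add: filterlim_at_top)
  have w_root: "eventually (\<lambda>n. 12 / \<theta> \<le> w n powr (1 / 4)) sequentially"
  proof -
    have "eventually (\<lambda>x. 12 / \<theta> \<le> x powr (1 / 4)) at_top" by real_asymp
    from eventually_compose_filterlim[OF this w_top] show ?thesis .
  qed
  have w_le: "eventually (\<lambda>n. w n \<le> (k n)\<^sup>2 / \<sigma>) sequentially"
    using \<sigma>(2) eventually_ge_at_top[of 2]
  proof eventually_elim
    case (elim n)
    have pos: "0 < \<sigma> * real n" using \<sigma>(1) elim by simp
    then have "0 < real (P n)" using elim by linarith
    then have "w n \<le> real n * (k n)\<^sup>2 / (\<sigma> * real n)"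
      unfolding w_def using elim pos by (intro divide_left_mono mult_pos_pos[OF _ pos]) auto
    then show ?case using elim by simp
  qed
  have k_top: "filterlim k at_top sequentially"
  proof -
    have "filterlim (\<lambda>n. sqrt (\<sigma> * w n)) at_top sequentially"
      by (intro filterlim_compose[OF sqrt_at_top] filterlim_tendsto_pos_mult_at_top[OF tendsto_const \<sigma>(1) w_top])
    then show ?thesis
    proof (rule filterlim_at_top_mono)
      show "eventually (\<lambda>n. sqrt (\<sigma> * w n) \<le> k n) sequentially"
        using w_le
      proof eventually_elim
        case (elim n)
        then have "\<sigma> * w n \<le> (k n)\<^sup>2" using \<sigma>(1) by (simp add: field_simps)
        then show ?case by (intro real_le_lsqrt) (auto simp: k_def)
      qed
    qed
  qed
  have t_0: "t \<longlonglongrightarrow> 0"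
  proof -
    have "((\<lambda>x. x powr (- 3 / 4)) \<longlongrightarrow> 0) (at_top :: real filter)" by real_asymp
    from filterlim_compose[OF this w_top] show ?thesis unfolding t_def .
  qed
  have g_bot: "filterlim (\<lambda>n. g (k n)) at_bot sequentially"
  proof -
    have "filterlim g at_bot at_top" unfolding g_def using \<sigma>(1) \<theta> by real_asymp
    from filterlim_compose[OF this k_top] show ?thesis .
  qed
  have quotient: "eventually (\<lambda>n. (k n)\<^sup>2 / \<sigma> > 0 \<and> ((k n)\<^sup>2 / \<sigma>) powr (1 / 4) / k n \<le> 1) sequentially"
  proof -
    have "eventually (\<lambda>x. x\<^sup>2 / \<sigma> > 0 \<and> (x\<^sup>2 / \<sigma>) powr (1 / 4) / x \<le> 1) at_top"
      using \<sigma>(1) by (intro eventually_conj) real_asymp+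
    from eventually_compose_filterlim[OF this k_top] show ?thesis .
  qed
  \<comment> \<open>The load bounds \<open>w\<close> by a multiple of \<open>ln n\<close>, so \<open>n t \<ge> n / w\<close> grows almost linearly.\<close>
  have nt: "eventually (\<lambda>n. 2 \<le> real n * t n) sequentially"
  proof -
    have "eventually (\<lambda>n. 2 \<le> real n / (2 * c * ln (real n))) sequentially" using c by real_asymp
    moreover have "eventually (\<lambda>n. load_ratio n < 2 * c) sequentially"
      by (rule order_tendstoD(2)[OF load_ratio_tendsto]) (use c in simp)
    ultimately show ?thesis
      using eventually_ge_at_top[of 2] w_ge[of 1]
    proof eventually_elim
      case (elim n)
      interpret key_ring_law \<mu> "K n" "P n" "K n 1" by (rule law) fact
      have "k n \<le> measure_pmf.expectation \<mu> (\<lambda>i. real (K n i))"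
      proof -
        have "measure_pmf.expectation \<mu> (\<lambda>i. k n) \<le> measure_pmf.expectation \<mu> (\<lambda>i. real (K n i))"
          using k_le by (intro integral_mono_AE integrable_classes) (auto simp: AE_measure_pmf_iff k_def)
        then show ?thesis by simp
      qed
      then have "w n \<le> real n * load n"
        unfolding w_def load_def k_def
        by (simp add: power2_eq_square divide_right_mono mult_left_mono)
      also have "\<dots> \<le> 2 * c * ln (real n)" 
        unfolding load_eq_ratio[OF \<open>2 \<le> n\<close>] using elim c by (intro mult_right_mono) auto
      finally have w: "w n \<le> 2 * c * ln (real n)" .
      then have "2 \<le> real n / w n" 
        using elim divide_left_mono[OF w, of "real n"] by (smt (verit) of_nat_0_le_iff mult_pos_pos)
      also have "\<dots> = real n * w n powr (- 1)" using elim by (simp add: powr_minus_divide)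
      also have "\<dots> \<le> real n * t n" unfolding t_def using elim by (intro mult_left_mono powr_mono) auto
      finally show ?case .
    qed
  qed
  have "(\<lambda>n. \<theta> * \<theta> * (1 - t n) * load_ratio n) \<longlonglongrightarrow> \<theta> * \<theta> * (1 - 0) * c"
    by (intro tendsto_intros t_0 load_ratio_tendsto)
  moreover have "1 + \<epsilon> < \<theta> * \<theta> * (1 - 0) * c" using \<epsilon> by (simp add: \<epsilon>_def power2_eq_square field_simps)
  ultimately have rate: "eventually (\<lambda>n. 1 + \<epsilon> < \<theta> * \<theta> * (1 - t n) * load_ratio n) sequentially"
    by (rule order_tendstoD)
  have lnn: "eventually (\<lambda>n. 1 \<le> \<epsilon> * ln (real n)) sequentially" using \<epsilon> by real_asymp
  have "(\<lambda>n. 3 * sqrt (t n)) \<longlonglongrightarrow> 3 * sqrt 0" by (intro tendsto_intros t_0)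
  then have sqrt_t: "eventually (\<lambda>n. 3 * sqrt (t n) < \<rho> / 4) sequentially"
    by (rule order_tendstoD) (use \<rho> in simp)
  have k_ge: "eventually (\<lambda>n. k n \<ge> 1 / (1 - \<theta>)) sequentially" using k_top by (simp add: filterlim_at_top)
  have g_le: "eventually (\<lambda>n. g (k n) \<le> - 1) sequentially" using g_bot by (simp add: filterlim_at_bot)
  let ?ub = "\<lambda>n. 2 * exp (g (k n)) + (2 * exp (- \<epsilon> * ln (real n)) + real n * exp (- (real n * (\<rho> / 4)))) + exp (- real n)"
  have lower: "eventually (\<lambda>n. 1 - ?ub n \<le> prob_connected n) sequentially"
    using eventually_ge_at_top[of 2] w_ge[of 1] w_root w_le quotient nt rate lnn sqrt_t k_ge g_le
      order_tendstoD(2)[OF t_0, of "1 / 2", simplified]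
  proof eventually_elim
    case (elim n)
    interpret key_ring_law \<mu> "K n" "P n" "K n 1" by (rule law) fact
    have w1: "w n \<ge> 1" by fact
    have t: "0 < t n" "t n \<le> 1 / 2" using w1 elim by (auto simp: t_def)
    have k: "0 < k n" using k_pos by (simp add: k_def)
    have P: "0 < real (P n)" using P_pos by simp
    have tw: "t n * w n = w n powr (1 / 4)"
    proof -
      have "w n powr (- 3 / 4 + 1) = w n powr (- 3 / 4) * w n powr 1" by (rule powr_add)
      then show ?thesis using w1 by (simp add: t_def)
    qed
    define q where "q = ((k n)\<^sup>2 / \<sigma>) powr (1 / 4) / k n"
    have "real n * t n * k n / real (P n) = t n * w n / k n"
      using k by (simp add: w_def power2_eq_square)
    also have "\<dots> \<le> q"
      unfolding tw q_def using elim w1 k by (intro divide_right_mono powr_mono2) auto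
    finally have ntk: "real n * t n * k n / real (P n) \<le> q" .
    have ntk0: "0 < real n * t n * k n / real (P n)" using t k P elim by auto
    have q: "0 < q" "q \<le> 1" using elim ntk ntk0 by (auto simp: q_def)
    have 1: "\<theta> * (real n * t n) * k n / real (P n) \<le> 1"
    proof -
      have "\<theta> * (real n * t n * k n / real (P n)) \<le> 1 * 1" using \<theta> ntk ntk0 q by (intro mult_mono) auto
      then show ?thesis by (simp add: mult_ac)
    qed
    have 2: "1 - ln (t n) + k n * (\<theta> + (1 - \<theta>) * ln (\<theta> * (real n * t n) * k n / real (P n))) \<le> g (k n)"
    proof -
      have "- ln (t n) = 3 / 4 * ln (w n)" using w1 by (simp add: t_def ln_powr)
      also have "\<dots> \<le> 3 / 4 * ln ((k n)\<^sup>2 / \<sigma>)" using elim w1 by (intro mult_left_mono) auto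
      finally have a: "- ln (t n) \<le> 3 / 4 * ln ((k n)\<^sup>2 / \<sigma>)" .
      have e: "\<theta> * (real n * t n) * k n / real (P n) = \<theta> * (real n * t n * k n / real (P n))" by simp
      have ln_theta: "ln (\<theta> * y) \<le> ln (\<theta> * q)" if "0 < y" "y \<le> q" for y using that \<theta> by simp
      have "ln (\<theta> * (real n * t n * k n / real (P n))) \<le> ln (\<theta> * q)"
        using ln_theta[OF ntk0 ntk] .
      then have "k n * (\<theta> + (1 - \<theta>) * ln (\<theta> * (real n * t n) * k n / real (P n))) \<le> k n * (\<theta> + (1 - \<theta>) * ln (\<theta> * q))"
        unfolding e using \<theta> k by (intro mult_left_mono add_left_mono) auto
      then show ?thesis using a unfolding g_def q_def by linarith
    qed
    have 3: "(1 + \<epsilon>) * ln (real n) \<le> (1 - \<delta> / 2) * \<theta> * (1 - t n) * (real n * load n)"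
    proof -
      have "(1 + \<epsilon>) * ln (real n) \<le> (\<theta> * \<theta> * (1 - t n) * load_ratio n) * ln (real n)"
        using elim by (intro mult_right_mono) auto
      moreover have "1 - \<delta> / 2 = \<theta>" by (simp add: \<delta>_def field_simps)
      ultimately show ?thesis using load_eq_ratio[OF \<open>2 \<le> n\<close>] by (simp add: mult_ac)
    qed
    have 4: "1 \<le> k n * (1 - \<theta>)" using \<theta> elim by (simp add: field_simps)
    have card: "card {1..n} = n" by simp
    have "measure_pmf.prob (rings n) {\<Sigma>. \<exists>S\<subseteq>{1..n}. S \<noteq> {} \<and> 2 * card S \<le> n \<and> separated {1..n} \<Sigma> S}
      \<le> 2 * exp (g (k n)) + (2 * exp (- \<epsilon> * ln (real n)) + real n * exp (- (real n * (\<rho> / 4))))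
        + exp (real n * (1 - \<theta> * t n * (real n * (k n)\<^sup>2 / real (P n)) / 6))"
      by (rule prob_cut_le_explicit[OF finite_atLeastAtMost card \<open>2 \<le> n\<close> \<theta> 4[unfolded k_def] t
            \<open>2 \<le> real n * t n\<close> 1[unfolded k_def] 2[unfolded k_def] \<open>g (k n) \<le> - 1\<close>[unfolded k_def]
            class_le[OF \<open>2 \<le> n\<close>] less_imp_le[OF \<delta>(1)] \<delta>(2) load_def 3 \<open>1 \<le> \<epsilon> * ln (real n)\<close> \<rho>_def
            less_imp_le[OF \<open>3 * sqrt (t n) < \<rho> / 4\<close>], folded k_def])
    also have "real n * (k n)\<^sup>2 / real (P n) = w n" by (simp add: w_def)
    also have "exp (real n * (1 - \<theta> * t n * w n / 6)) \<le> exp (- real n)"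
    proof -
      have "12 / \<theta> \<le> t n * w n" unfolding tw by fact
      then have "12 \<le> \<theta> * t n * w n" using \<theta> by (simp add: field_simps)
      then have "real n * (1 - \<theta> * t n * w n / 6) \<le> real n * (- 1)" by (intro mult_left_mono) auto
      then show ?thesis by simp
    qed
    finally have "measure_pmf.prob (rings n) {\<Sigma>. \<exists>S\<subseteq>{1..n}. S \<noteq> {} \<and> 2 * card S \<le> n \<and> separated {1..n} \<Sigma> S} \<le> ?ub n"
      by simp
    then show ?case using prob_connected_ge[of n] elim by linarith
  qed
  have limit: "(\<lambda>n. 1 - ?ub n) \<longlonglongrightarrow> 1"
  proof -
    have "(\<lambda>n. exp (g (k n))) \<longlonglongrightarrow> 0" by (rule filterlim_compose[OF exp_at_bot g_bot])
    moreover have "(\<lambda>n. exp (- \<epsilon> * ln (real n))) \<longlonglongrightarrow> 0" using \<epsilon> by real_asymp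
    moreover have "(\<lambda>n. real n * exp (- (real n * (\<rho> / 4)))) \<longlonglongrightarrow> 0" using \<rho> by real_asymp
    moreover have "(\<lambda>n. exp (- real n)) \<longlonglongrightarrow> 0" by real_asymp
    ultimately have "(\<lambda>n. 1 - ?ub n) \<longlonglongrightarrow> 1 - (2 * 0 + (2 * 0 + 0) + 0)" by (intro tendsto_intros)
    then show ?thesis by simp
  qed
  show ?thesis
    by (rule tendsto_sandwich[OF lower _ limit tendsto_const]) (simp add: prob_connected_def)
qed

end

theorem corollary3p3:
  fixes r :: nat and \<mu> :: "nat pmf"
    and K :: "nat \<Rightarrow> nat \<Rightarrow> nat" and P :: "nat \<Rightarrow> nat" and c :: real
  assumes "r \<ge> 1"
    and "set_pmf \<mu> = {1..r}"
    and "scaling r K P"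
    and "c > 0"
    and "(\<lambda>n. real (K n 1) * measure_pmf.expectation \<mu> (\<lambda>i. real (K n i)) / real (P n))
           \<sim>[at_top] (\<lambda>n. c * (ln (real n) / real n))"
  shows
    "((c < 1 \<longrightarrow>
         (\<lambda>n. measure_pmf.prob (inhom_random_key_graph n \<mu> (K n) (P n))
                {G. \<not> (\<exists>v. isolated_node (with_proj G) v)}) \<longlonglongrightarrow> 0) \<and>
      (c > 1 \<longrightarrow>
         (\<lambda>n. measure_pmf.prob (inhom_random_key_graph n \<mu> (K n) (P n))
                {G. \<not> (\<exists>v. isolated_node (with_proj G) v)}) \<longlonglongrightarrow> 1)) \<and>
     ((\<lambda>n. real (P n)) \<in> \<Omega>(\<lambda>n. real n) \<and>
      (\<lambda>n. (real (K n 1))\<^sup>2 / real (P n)) \<in> \<omega>(\<lambda>n. 1 / real n) \<longrightarrow>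
      (c < 1 \<longrightarrow>
         (\<lambda>n. measure_pmf.prob (inhom_random_key_graph n \<mu> (K n) (P n))
                {G. Digraph_Component.connected (with_proj G)}) \<longlonglongrightarrow> 0) \<and>
      (c > 1 \<longrightarrow>
         (\<lambda>n. measure_pmf.prob (inhom_random_key_graph n \<mu> (K n) (P n))
                {G. Digraph_Component.connected (with_proj G)}) \<longlonglongrightarrow> 1))"
proof -
  interpret critical_scaling r \<mu> K P c using assms by unfold_locales
  show ?thesis
    using prob_no_isolated_tendsto_0 prob_no_isolated_tendsto_1 prob_connected_tendsto_0 prob_connected_tendsto_1
    unfolding prob_no_isolated_def prob_connected_def by blast
qed

end
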